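(* Let $\Omega$ be a locally compact Hausdorff space with Borel $\sigma$-algebra $\mathcal{B}$, let $X$ be a real Banach space with dual $X^*$, and let $\Gamma,\Gamma_n:\Omega\to cwk(X)$, $n\in\mathbb{N}$, be scalarly measurable multifunctions. Let $m, m_n$, $n\in\mathbb{N}$, be measures in $\mathcal{M}(\Omega)$ with $m$ Radon. Suppose that (j) the sequence $(\Gamma_n)_n$ and the multifunction $\Gamma$ have uniformly absolutely continuous scalar $(m_n)$-integrals on $\Omega$; (jj) for each $x^*\in X^*$, $s(x^*,\Gamma_n)\to s(x^*,\Gamma)$ $m$-a.e.; (jjj) $\Gamma$ is scalarly continuous; (jv) $(m_n)_n$ is vaguely convergent to $m$ and uniformly absolutely continuous with respect to $m$; (v) each multifunction $\Gamma_n$ is Pettis $m_n$-integrable (in $cwk(X)$). Then $\Gamma$ is Pettis $m$-integrable in $cwk(X)$ and $$\lim_n s\Big(x^*,\int_A\Gamma_n\,dm_n\Big)=s\Big(x^*,\int_A\Gamma\,dm\Big)$$ for every $x^*\in X^*$ and every $A\in\mathcal{B}$.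
   Context: $\mathcal{M}(\Omega)$ denotes the family of finite nonnegative (countably additive) measures on $(\Omega,\mathcal{B})$. A measure $m\in\mathcal{M}(\Omega)$ is Radon if it is inner regular with respect to compact sets. Vague convergence of $(m_n)_n$ to $m$: $\int_\Omega g\,dm_n\to\int_\Omega g\,dm$ for every $g\in C_0(\Omega)$, the continuous real functions on $\Omega$ vanishing at infinity. $(m_n)_n$ is uniformly absolutely continuous with respect to $m$ if for each $\varepsilon>0$ there is $\delta>0$ such that for every $E\in\mathcal{B}$: $m(E)<\delta$ implies $\sup_n m_n(E)<\varepsilon$. $cwk(X)$ is the family of all nonempty weakly compact convex subsets of $X$. For $C\in cwk(X)$ and $x^*\in X^*$, the support function is $s(x^*,C)=\sup\{\langle x^*,x\rangle: x\in C\}$. For a multifunction $\Gamma:\Omega\to cwk(X)$, $s(x^*,\Gamma)$ denotes the function $t\mapsto s(x^*,\Gamma(t))$. $\Gamma$ is scalarly measurable (resp. scalarly $m$-integrable, scalarly continuous) if $s(x^*,\Gamma)$ is $\mathcal{B}$-measurable (resp. $m$-integrable, continuous) for every $x^*\in X^*$. $\Gamma$ is Pettis $m$-integrable in $cwk(X)$ if it is scalarly $m$-integrable and for every $A\in\mathcal{B}$ there is a set $\int_A\Gamma\,dm\in cwk(X)$ such that $s(x^*,\int_A\Gamma\,dm)=\int_A s(x^*,\Gamma)\,dm$ for all $x^*\in X^*$. A sequence $(\Gamma_n)_n$ of multifunctions with $\Gamma_n$ scalarly $m_n$-integrable for each $n$ has uniformly absolutely continuous scalar $(m_n)$-integrals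 on $\Omega$ if for every $\varepsilon>0$ there is $\delta>0$ such that for every $n\in\mathbb{N}$ and $A\in\mathcal{B}$: $m_n(A)<\delta$ implies $\sup\{\int_A|s(x^*,\Gamma_n)|\,dm_n: \|x^*\|\le 1\}<\varepsilon$. A single multifunction $\Gamma$ has this property if the condition holds with $\Gamma_n:=\Gamma$ for every $n$ (in particular $\Gamma$ is then scalarly $m_n$-integrable for each $n$). *)

theory Defs
  imports "HOL-Analysis.Analysis"
begin

text \<open>The dual of \<open>'b\<close> is the type \<open>'b \<Rightarrow>\<^sub>L real\<close> of bounded linear functionals with the operator norm.
  The Borel space \<open>(\<Omega>, \<B>)\<close> is \<open>borel\<close> on a topological type; a measure on it is a value
  \<open>m :: 'a measure\<close> with \<open>sets m = sets borel\<close>.\<close>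

definition finite_borel_measures :: "'a::topological_space measure set"
  where "finite_borel_measures = {m. sets m = sets borel \<and> finite_measure m}"

definition radon :: "'a::topological_space measure \<Rightarrow> bool"
  where "radon m \<longleftrightarrow>
    (\<forall>A\<in>sets borel. emeasure m A = (SUP K\<in>{K. compact K \<and> K \<subseteq> A}. emeasure m K))"

definition C0_functions :: "('a::topological_space \<Rightarrow> real) set"
  where "C0_functions =
    {g. continuous_on UNIV g \<and> (\<forall>e>0. \<exists>K. compact K \<and> (\<forall>t. t \<notin> K \<longrightarrow> \<bar>g t\<bar> < e))}"

definition vaguely_converges ::
    "(nat \<Rightarrow> 'a::topological_space measure) \<Rightarrow> 'a measure \<Rightarrow> bool"
  where "vaguely_converges ms m \<longleftrightarrow>
    (\<forall>g\<in>C0_functions. (\<lambda>n. LINT t|ms n. g t) \<longlonglongrightarrow> (LINT t|m. g t))"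

text \<open>Suprema of measures and of integrals of nonnegative functions are taken in \<open>ennreal\<close>, where
  an unbounded family has supremum \<open>\<infinity>\<close>; the supremum of an unbounded set of reals is unspecified.\<close>

definition unif_abs_continuous ::
    "(nat \<Rightarrow> 'a::topological_space measure) \<Rightarrow> 'a measure \<Rightarrow> bool"
  where "unif_abs_continuous ms m \<longleftrightarrow>
    (\<forall>e::real. e > 0 \<longrightarrow> (\<exists>d::real. d > 0 \<and>
      (\<forall>E\<in>sets borel. emeasure m E < ennreal d \<longrightarrow> (SUP n. emeasure (ms n) E) < ennreal e)))"

text \<open>As for \<open>strong_operator_topology\<close>: the pullback of the product topology on
  \<open>('b \<Rightarrow>\<^sub>L real) \<Rightarrow> real\<close> along evaluation is the initial topology of all functionals.\<close>

definition weak_topology :: "'b::real_normed_vector topology"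
  where "weak_topology =
    pullback_topology UNIV (\<lambda>(x::'b) (f :: 'b \<Rightarrow>\<^sub>L real). blinfun_apply f x) euclidean"

definition cwk :: "'b::real_normed_vector set set"
  where "cwk = {C. C \<noteq> {} \<and> convex C \<and> compactin weak_topology C}"

text \<open>A real supremum; the set is nonempty and bounded above for every member of \<open>cwk\<close>.\<close>

definition support_fun :: "('b::real_normed_vector \<Rightarrow>\<^sub>L real) \<Rightarrow> 'b set \<Rightarrow> real"
  where "support_fun f C = (SUP x\<in>C. blinfun_apply f x)"

definition scalarly_measurable ::
    "('a::topological_space \<Rightarrow> 'b::real_normed_vector set) \<Rightarrow> bool"
  where "scalarly_measurable \<Gamma> \<longleftrightarrow> (\<forall>f. (\<lambda>t. support_fun f (\<Gamma> t)) \<in> borel_measurable borel)"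

definition scalarly_integrable ::
    "'a::topological_space measure \<Rightarrow> ('a \<Rightarrow> 'b::real_normed_vector set) \<Rightarrow> bool"
  where "scalarly_integrable m \<Gamma> \<longleftrightarrow> (\<forall>f. integrable m (\<lambda>t. support_fun f (\<Gamma> t)))"

definition scalarly_continuous ::
    "('a::topological_space \<Rightarrow> 'b::real_normed_vector set) \<Rightarrow> bool"
  where "scalarly_continuous \<Gamma> \<longleftrightarrow> (\<forall>f. continuous_on UNIV (\<lambda>t. support_fun f (\<Gamma> t)))"

definition has_pettis_integral ::
    "'a::topological_space measure \<Rightarrow> ('a \<Rightarrow> 'b::real_normed_vector set) \<Rightarrow> 'a set \<Rightarrow> 'b set \<Rightarrow> bool"
  where "has_pettis_integral m \<Gamma> A C \<longleftrightarrow>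
    C \<in> cwk \<and> (\<forall>f. support_fun f C = (LINT t:A|m. support_fun f (\<Gamma> t)))"

definition pettis_integrable ::
    "'a::topological_space measure \<Rightarrow> ('a \<Rightarrow> 'b::real_normed_vector set) \<Rightarrow> bool"
  where "pettis_integrable m \<Gamma> \<longleftrightarrow>
    scalarly_integrable m \<Gamma> \<and> (\<forall>A\<in>sets borel. \<exists>C. has_pettis_integral m \<Gamma> A C)"

text \<open>The integral over a given set is unique by the Hahn-Banach theorem, since members of \<open>cwk\<close> are
  convex and norm closed. The choice operator only avoids building that fact into the definition.\<close>

definition pettis_integral ::
    "'a::topological_space measure \<Rightarrow> ('a \<Rightarrow> 'b::real_normed_vector set) \<Rightarrow> 'a set \<Rightarrow> 'b set"
  where "pettis_integral m \<Gamma> A = (SOME C. has_pettis_integral m \<Gamma> A C)"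

definition unif_abs_cont_scalar_integrals ::
    "(nat \<Rightarrow> 'a::topological_space measure) \<Rightarrow> (nat \<Rightarrow> 'a \<Rightarrow> 'b::real_normed_vector set) \<Rightarrow> bool"
  where "unif_abs_cont_scalar_integrals ms \<Gamma>s \<longleftrightarrow>
    (\<forall>n. scalarly_integrable (ms n) (\<Gamma>s n)) \<and>
    (\<forall>e::real. e > 0 \<longrightarrow> (\<exists>d::real. d > 0 \<and>
      (\<forall>n. \<forall>A\<in>sets borel. emeasure (ms n) A < ennreal d \<longrightarrow>
        (SUP f\<in>{f. norm f \<le> 1}.
          \<integral>\<^sup>+t\<in>A. ennreal \<bar>support_fun f (\<Gamma>s n t)\<bar> \<partial>ms n) < ennreal e)))"

end

theory Submission
  imports Defs
begin

text \<open>The proof has a measure-theoretic half and a functional-analytic half.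

  Since \<open>m\<close> is Radon, every Borel set \<open>A\<close> lies between a compact \<open>K\<close> and an open \<open>U\<close> with
  \<open>m (U - K)\<close> small; uniform absolute continuity makes \<open>ms n (U - K)\<close> small uniformly in \<open>n\<close>, so
  an Urysohn function between \<open>K\<close> and \<open>U\<close> turns vague convergence into setwise convergence
  (\<open>vague_imp_setwise\<close>). Setwise convergence passes to integrals of bounded functions, and
  truncation transfers the uniform smallness of the scalar integrals of \<open>\<Gamma>\<close> from the \<open>ms n\<close> to
  \<open>m\<close> (\<open>setwise_limit_tail_bound\<close>), so \<open>\<Gamma>\<close> is scalarly \<open>m\<close>-integrable. A Vitali argument, in
  which the integrands and the measures vary together, then gives the convergence of the scalar
  integrals over every Borel set (\<open>vitali_varying_measures\<close>). The limit formula thus holds as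
  soon as the integrals of \<open>\<Gamma>\<close> exist as weakly compact convex sets.

  For existence, fix \<open>A\<close> and let \<open>p f\<close> be the integral of \<open>s(f, \<Gamma>)\<close> over \<open>A\<close>, a sublinear
  functional on the dual. By Hahn-Banach and Tychonoff, \<open>p\<close> is the support function of a member
  of \<open>cwk\<close> if every linear \<open>\<phi> \<le> p\<close> is evaluation at a point (\<open>ex_cwk_support_fun\<close>). Outside a
  large compact \<open>K\<close> the integral contributes at most \<open>e * norm f\<close>; on \<open>K\<close> scalar continuity makes
  \<open>W = (\<Union>t\<in>K. \<Gamma> t)\<close> weakly compact (\<open>weakly_compact_UN\<close>). So \<open>\<phi>\<close> is dominated by a multiple of
  the positive part of the support function of \<open>W\<close>, up to \<open>e * norm f\<close>, and it remains to show
  that such a \<open>\<phi>\<close> is within \<open>2 * e\<close> of an evaluation (\<open>krein_approximation\<close>). This is Krein's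
  theorem on closed convex hulls in disguise. If it failed, there would be functionals of norm at
  most one, with \<open>\<phi>\<close> at least \<open>2 * e\<close> on each, that vanish on larger and larger finite nets of
  \<open>W\<close>; they tend to zero pointwise on \<open>W\<close> (\<open>weak_null_on_compact\<close>), so by Simons' inequality a
  limit of convex combinations of them has a small supremum on \<open>W\<close> (\<open>simons_inequality\<close>), which
  contradicts the domination. Letting \<open>e\<close> tend to zero and using the completeness of the space
  identifies \<open>\<phi>\<close> (\<open>eval_if_nearly_dominated\<close>).\<close>

section \<open>Sublinear functionals and the Hahn-Banach theorem\<close>

definition sublinear :: "('v::real_vector \<Rightarrow> real) \<Rightarrow> bool"
  where "sublinear p \<longleftrightarrow>
    (\<forall>u v. p (u + v) \<le> p u + p v) \<and> (\<forall>c u. c \<ge> 0 \<longrightarrow> p (c *\<^sub>R u) = c * p u)"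

lemma sublinear_add: "sublinear p \<Longrightarrow> p (u + v) \<le> p u + p v"
  by (simp add: sublinear_def)

lemma sublinear_scale: "sublinear p \<Longrightarrow> c \<ge> 0 \<Longrightarrow> p (c *\<^sub>R u) = c * p u"
  by (simp add: sublinear_def)

lemma sublinear_0: "sublinear p \<Longrightarrow> p 0 = 0"
  using sublinear_scale[of p 0 0] by simp

lemma sublinear_minus: "sublinear p \<Longrightarrow> - p (- u) \<le> p u"
  using sublinear_add[of p u "- u"] by (simp add: sublinear_0)

lemma sublinearI:
  assumes "\<And>u v. p (u + v) \<le> p u + p v" "p 0 = 0" "\<And>c u. c > 0 \<Longrightarrow> p (c *\<^sub>R u) \<le> c * p u"
  shows "sublinear p"
  unfolding sublinear_def
proof (intro conjI allI impI assms(1))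
  fix c :: real and u assume "c \<ge> 0"
  show "p (c *\<^sub>R u) = c * p u"
  proof (cases "c = 0")
    case False
    with \<open>c \<ge> 0\<close> have "c > 0" by simp
    then have "p (inverse c *\<^sub>R (c *\<^sub>R u)) \<le> inverse c * p (c *\<^sub>R u)"
      by (intro assms(3)) simp
    then have "c * p u \<le> p (c *\<^sub>R u)"
      using \<open>c > 0\<close> by (simp add: field_simps)
    then show ?thesis using assms(3)[OF \<open>c > 0\<close>, of u] by simp
  qed (simp add: assms)
qed

text \<open>The largest sublinear functional below a sublinear \<open>p\<close> that takes the value \<open>- p v\<close> at \<open>- v\<close>, that
  is, the one obtained from \<open>p\<close> by forcing additivity in the direction \<open>v\<close>.\<close>

definition flatten_along :: "'v::real_vector \<Rightarrow> ('v \<Rightarrow> real) \<Rightarrow> 'v \<Rightarrow> real"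
  where "flatten_along v p u = (INF t\<in>{0..}. p (u + t *\<^sub>R v) - t * p v)"

lemma flatten_along_le:
  assumes "sublinear p" "t \<ge> 0"
  shows "flatten_along v p u \<le> p (u + t *\<^sub>R v) - t * p v"
proof -
  have "bdd_below ((\<lambda>t. p (u + t *\<^sub>R v) - t * p v) ` {0..})"
  proof (rule bdd_belowI2)
    fix t :: real assume "t \<in> {0..}"
    then have "t * p v = p ((u + t *\<^sub>R v) + (- u))" using assms(1) by (simp add: sublinear_scale)
    also have "\<dots> \<le> p (u + t *\<^sub>R v) + p (- u)" by (rule sublinear_add[OF assms(1)])
    finally show "- p (- u) \<le> p (u + t *\<^sub>R v) - t * p v" by simp
  qed
  then show ?thesis unfolding flatten_along_def using assms(2) by (intro cINF_lower) auto
qed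

lemma flatten_along_greatest:
  assumes "\<And>t. t \<ge> 0 \<Longrightarrow> c \<le> p (u + t *\<^sub>R v) - t * p v"
  shows "c \<le> flatten_along v p u"
  unfolding flatten_along_def using assms by (intro cINF_greatest) auto

lemma sublinear_flatten_along:
  assumes p: "sublinear p"
  shows "sublinear (flatten_along v p)"
proof (rule sublinearI)
  fix u w
  have *: "flatten_along v p (u + w) \<le> (p (u + s *\<^sub>R v) - s * p v) + (p (w + t *\<^sub>R v) - t * p v)"
    if "s \<ge> 0" "t \<ge> 0" for s t
  proof -
    have "flatten_along v p (u + w) \<le> p ((u + w) + (s + t) *\<^sub>R v) - (s + t) * p v"
      using that by (intro flatten_along_le p) simp
    also have "(u + w) + (s + t) *\<^sub>R v = (u + s *\<^sub>R v) + (w + t *\<^sub>R v)"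
      by (simp add: algebra_simps)
    also have "p \<dots> \<le> p (u + s *\<^sub>R v) + p (w + t *\<^sub>R v)" by (rule sublinear_add[OF p])
    finally show ?thesis by (simp add: algebra_simps)
  qed
  have "flatten_along v p (u + w) - flatten_along v p u \<le> p (w + t *\<^sub>R v) - t * p v" if "t \<ge> 0" for t
  proof -
    have "flatten_along v p (u + w) - (p (w + t *\<^sub>R v) - t * p v) \<le> flatten_along v p u"
      by (rule flatten_along_greatest) (use * that in force)
    then show ?thesis by simp
  qed
  then have "flatten_along v p (u + w) - flatten_along v p u \<le> flatten_along v p w"
    by (rule flatten_along_greatest)
  then show "flatten_along v p (u + w) \<le> flatten_along v p u + flatten_along v p w" by simp
next
  have "p (0 + t *\<^sub>R v) - t * p v = 0" if "t \<ge> 0" for t using p that by (simp add: sublinear_scale)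
  then show "flatten_along v p 0 = 0"
    unfolding flatten_along_def by (simp cong: INF_cong_simp)
next
  fix c :: real and u assume c: "c > 0"
  have "flatten_along v p (c *\<^sub>R u) / c \<le> p (u + t *\<^sub>R v) - t * p v" if "t \<ge> 0" for t
  proof -
    have "flatten_along v p (c *\<^sub>R u) \<le> p (c *\<^sub>R u + (c * t) *\<^sub>R v) - (c * t) * p v"
      using that c by (intro flatten_along_le p) simp
    also have "c *\<^sub>R u + (c * t) *\<^sub>R v = c *\<^sub>R (u + t *\<^sub>R v)" by (simp add: algebra_simps)
    also have "p \<dots> = c * p (u + t *\<^sub>R v)" using c by (intro sublinear_scale p) simp
    finally show ?thesis using c by (simp add: field_simps)
  qed
  then have "flatten_along v p (c *\<^sub>R u) / c \<le> flatten_along v p u"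
    by (rule flatten_along_greatest)
  then show "flatten_along v p (c *\<^sub>R u) \<le> c * flatten_along v p u" using c by (simp add: field_simps)
qed

text \<open>Zorn's lemma applies because the pointwise infimum of a chain of sublinear functionals below \<open>p\<close> is
  bounded below by \<open>\<lambda>v. - p (- v)\<close> and again sublinear.\<close>

lemma ex_minimal_sublinear:
  fixes p :: "'v::real_vector \<Rightarrow> real"
  assumes p: "sublinear p"
  obtains q where "sublinear q" "q \<le> p" "\<forall>r. sublinear r \<and> r \<le> q \<longrightarrow> r = q"
proof -
  let ?A = "{q. sublinear q \<and> q \<le> p}"
  let ?P = "\<lambda>a b :: 'v \<Rightarrow> real. b \<le> a"
  have "\<exists>m\<in>?A. \<forall>a\<in>?A. ?P m a \<longrightarrow> a = m"
  proof (rule predicate_Zorn)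
    show "partial_order_on ?A (relation_of ?P ?A)"
      by (rule partial_order_on_relation_ofI) auto
  next
    fix C assume C: "C \<in> Chains (relation_of ?P ?A)"
    then have CA: "\<And>q. q \<in> C \<Longrightarrow> sublinear q \<and> q \<le> p"
      and cmp: "\<And>q r. q \<in> C \<Longrightarrow> r \<in> C \<Longrightarrow> q \<le> r \<or> r \<le> q"
      unfolding Chains_def relation_of_def by blast+
    show "\<exists>u\<in>?A. \<forall>a\<in>C. ?P a u"
    proof (cases "C = {}")
      case True
      then show ?thesis using p by blast
    next
      case False
      define u where "u = (\<lambda>v. INF q\<in>C. q v)"
      have bdd: "bdd_below ((\<lambda>q. q v) ` C)" for v
      proof (rule bdd_belowI2)
        fix q assume q: "q \<in> C"
        have "- p (- v) \<le> - q (- v)" using CA[OF q] by (simp add: le_fun_def)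
        also have "\<dots> \<le> q v" using CA[OF q] by (intro sublinear_minus) simp
        finally show "- p (- v) \<le> q v" .
      qed
      have u_le: "u v \<le> q v" if "q \<in> C" for q v
        unfolding u_def using that by (intro cINF_lower bdd)
      have u_ge: "c \<le> u v" if "\<And>q. q \<in> C \<Longrightarrow> c \<le> q v" for c v
        unfolding u_def using that False by (intro cINF_greatest) auto
      have "sublinear u"
      proof (rule sublinearI)
        fix v w
        have *: "u (v + w) \<le> q v + r w" if qr: "q \<in> C" "r \<in> C" for q r
        proof -
          obtain s where s: "s \<in> C" "s \<le> q" "s \<le> r" using cmp[OF qr] qr by blast
          have "u (v + w) \<le> s (v + w)" by (rule u_le[OF s(1)])
          also have "\<dots> \<le> s v + s w" using CA[OF s(1)] by (intro sublinear_add) simp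
          also have "\<dots> \<le> q v + r w" using s by (intro add_mono) (auto simp: le_fun_def)
          finally show ?thesis .
        qed
        have "u (v + w) - r w \<le> u v" if "r \<in> C" for r
          by (rule u_ge) (use * that in force)
        then have "u (v + w) - u v \<le> u w" by (intro u_ge) force
        then show "u (v + w) \<le> u v + u w" by simp
      next
        have "q 0 = 0" if "q \<in> C" for q using CA[OF that] sublinear_0 by blast
        then have "(INF q\<in>C. q 0) = (INF q\<in>C. 0)" by (intro INF_cong) auto
        then show "u 0 = 0" unfolding u_def using False by simp
      next
        fix c :: real and v assume c: "c > 0"
        have "u (c *\<^sub>R v) / c \<le> q v" if "q \<in> C" for q
          using u_le[OF that, of "c *\<^sub>R v"] CA[OF that] c
          by (simp add: sublinear_scale field_simps)
        then have "u (c *\<^sub>R v) / c \<le> u v" by (rule u_ge)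
        then show "u (c *\<^sub>R v) \<le> c * u v" using c by (simp add: field_simps)
      qed
      moreover have "u \<le> p"
      proof -
        obtain q where "q \<in> C" using False by blast
        then have "u v \<le> p v" for v using u_le[of q v] CA[of q] le_funD[of q p v] by fastforce
      then show ?thesis by (rule le_funI)
      qed
      ultimately show ?thesis using u_le by (auto simp: le_fun_def)
    qed
  qed
  then obtain m where m: "m \<in> ?A" "\<forall>a\<in>?A. a \<le> m \<longrightarrow> a = m" by blast
  show ?thesis
  proof (rule that[of m])
    show "\<forall>r. sublinear r \<and> r \<le> m \<longrightarrow> r = m"
      using m by (auto intro: order_trans)
  qed (use m in auto)
qed

text \<open>A minimal sublinear functional \<open>q\<close> equals all its flattenings, which says that it is additive and
  hence linear. Starting the minimization from \<open>flatten_along x p\<close> instead of \<open>p\<close> forces the value at \<open>x\<close>.\<close>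

theorem hahn_banach_sublinear:
  fixes p :: "'v::real_vector \<Rightarrow> real"
  assumes p: "sublinear p"
  obtains \<phi> where "linear \<phi>" "\<And>v. \<phi> v \<le> p v" "\<phi> x = p x"
proof -
  obtain q where q: "sublinear q" "q \<le> flatten_along x p"
    and min: "\<forall>r. sublinear r \<and> r \<le> q \<longrightarrow> r = q"
    by (rule ex_minimal_sublinear[OF sublinear_flatten_along[OF p, of x]])
  have q_le: "q v \<le> p (v + t *\<^sub>R x) - t * p x" if "t \<ge> 0" for v t
    using le_funD[OF q(2), of v] flatten_along_le[OF p that, of x v] by linarith
  have add: "q (u + v) = q u + q v" for u v
  proof (rule antisym)
    have "flatten_along v q = q"
    proof (rule min[rule_format], intro conjI sublinear_flatten_along[OF q(1)] le_funI)
      show "flatten_along v q u \<le> q u" for u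
        using flatten_along_le[OF q(1), of 0 v u] by simp
    qed
    then show "q u + q v \<le> q (u + v)"
      using flatten_along_le[OF q(1), of 1 v u] by simp
  qed (rule sublinear_add[OF q(1)])
  have neg: "q (- u) = - q u" for u
    using add[of u "- u"] by (simp add: sublinear_0[OF q(1)])
  have "linear q"
  proof (rule linearI)
    fix c :: real and u
    show "q (c *\<^sub>R u) = c *\<^sub>R q u"
    proof (cases "c \<ge> 0")
      case False
      then have "q ((- c) *\<^sub>R u) = (- c) * q u" by (intro sublinear_scale q) simp
      then show ?thesis using neg[of "c *\<^sub>R u"] by simp
    qed (simp add: sublinear_scale[OF q(1)])
  qed (rule add)
  moreover have "q v \<le> p v" for v using q_le[of 0 v] by simp
  moreover have "q x = p x"
    using q_le[of 1 "- x"] \<open>q x \<le> p x\<close> neg[of x] by (simp add: sublinear_0[OF p])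
  ultimately show ?thesis using that by blast
qed

section \<open>Weakly compact sets and their support functions\<close>

text \<open>The canonical image of a point in the bidual, seen as a bare function so that it lives in the product
  space over the dual, where Tychonoff's theorem is available.\<close>

abbreviation eval_at :: "'b::real_normed_vector \<Rightarrow> ('b \<Rightarrow>\<^sub>L real) \<Rightarrow> real"
  where "eval_at x \<equiv> (\<lambda>f. blinfun_apply f x)"

lemma weakly_compact_iff:
  "compactin weak_topology (C :: 'b::real_normed_vector set) \<longleftrightarrow> compact (eval_at ` C)"
proof
  assume C: "compactin weak_topology C"
  have "continuous_map (weak_topology :: 'b topology) euclidean eval_at"
    using continuous_map_pullback[OF continuous_map_id, of UNIV "eval_at :: 'b \<Rightarrow> _" euclidean]
    by (simp add: weak_topology_def)
  from image_compactin[OF C this] show "compact (eval_at ` C)" by simp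
next
  assume C: "compact (eval_at ` C)"
  show "compactin weak_topology C"
    unfolding compactin_def
  proof (intro conjI allI impI)
    show "C \<subseteq> topspace weak_topology"
      by (simp add: weak_topology_def topspace_pullback_topology)
  next
    fix \<U> :: "'b set set" assume U: "(\<forall>U\<in>\<U>. openin weak_topology U) \<and> C \<subseteq> \<Union>\<U>"
    have "\<forall>U\<in>\<U>. \<exists>V. open V \<and> U = eval_at -` V"
      using U by (simp add: weak_topology_def openin_pullback_topology)
    then obtain V where V: "\<And>U. U \<in> \<U> \<Longrightarrow> open (V U) \<and> U = eval_at -` (V U)" by metis
    have "eval_at ` C \<subseteq> (\<Union>U\<in>\<U>. V U)"
    proof (rule image_subsetI)
      fix x assume "x \<in> C"
      then obtain U where "U \<in> \<U>" "x \<in> U" using U by blast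
      then show "eval_at x \<in> (\<Union>U\<in>\<U>. V U)" using V[of U] by blast
    qed
    then obtain D where D: "D \<subseteq> \<U>" "finite D" "eval_at ` C \<subseteq> (\<Union>U\<in>D. V U)"
      using V by (auto intro: compactE_image[OF C, of \<U> V])
    have "C \<subseteq> \<Union>D"
    proof
      fix x assume "x \<in> C"
      then obtain U where "U \<in> D" "eval_at x \<in> V U" using D(3) by blast
      then show "x \<in> \<Union>D" using V[of U] D(1) by blast
    qed
    then show "\<exists>\<F>. finite \<F> \<and> \<F> \<subseteq> \<U> \<and> C \<subseteq> \<Union>\<F>" using D by blast
  qed
qed

lemma weakly_compact_image:
  fixes C :: "'b::real_normed_vector set" and f :: "'b \<Rightarrow>\<^sub>L real"
  assumes "compactin weak_topology C"
  shows "compact (blinfun_apply f ` C)"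
proof -
  have "compact ((\<lambda>\<psi>. \<psi> f) ` eval_at ` C)"
    by (rule compact_continuous_image[OF continuous_on_subset[OF continuous_on_product_coordinates]])
      (use assms in \<open>auto simp: weakly_compact_iff\<close>)
  then show ?thesis by (simp add: image_image)
qed

lemma weakly_compact_level_set:
  fixes C :: "'b::real_normed_vector set" and f :: "'b \<Rightarrow>\<^sub>L real"
  assumes "compactin weak_topology C"
  shows "compactin weak_topology {x \<in> C. blinfun_apply f x = c}"
proof -
  have "closed {\<psi> :: ('b \<Rightarrow>\<^sub>L real) \<Rightarrow> real. \<psi> f = c}"
    by (intro closed_Collect_eq continuous_on_product_coordinates continuous_on_const)
  then have "compact (eval_at ` C \<inter> {\<psi>. \<psi> f = c})"
    using assms by (intro compact_Int_closed) (simp_all add: weakly_compact_iff)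
  also have "eval_at ` C \<inter> {\<psi>. \<psi> f = c} = eval_at ` {x \<in> C. blinfun_apply f x = c}" by auto
  finally show ?thesis by (simp add: weakly_compact_iff)
qed

lemma support_fun_upper:
  fixes C :: "'b::real_normed_vector set"
  assumes "compactin weak_topology C" "x \<in> C"
  shows "blinfun_apply f x \<le> support_fun f C"
  unfolding support_fun_def
  by (rule cSUP_upper[OF assms(2) bounded_imp_bdd_above[OF compact_imp_bounded]])
    (rule weakly_compact_image[OF assms(1)])

text \<open>Weak compactness is used most often in this form: every functional attains its supremum.\<close>

lemma support_fun_attained:
  fixes C :: "'b::real_normed_vector set"
  assumes "compactin weak_topology C" "C \<noteq> {}"
  obtains x where "x \<in> C" "blinfun_apply f x = support_fun f C"
proof -
  obtain x where x: "x \<in> C" "\<And>y. y \<in> C \<Longrightarrow> blinfun_apply f y \<le> blinfun_apply f x"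
    using compact_attains_sup[OF weakly_compact_image[OF assms(1)], of f] assms(2) by auto
  have "support_fun f C \<le> blinfun_apply f x"
    unfolding support_fun_def using assms(2) x(2) by (rule cSUP_least)
  with support_fun_upper[OF assms(1) x(1), of f] x(1) show ?thesis by (intro that[of x]) auto
qed

lemma sublinear_support_fun:
  fixes C :: "'b::real_normed_vector set"
  assumes C: "compactin weak_topology C" "C \<noteq> {}"
  shows "sublinear (\<lambda>f. support_fun f C)"
proof (rule sublinearI)
  fix f g :: "'b \<Rightarrow>\<^sub>L real"
  obtain x where x: "x \<in> C" "blinfun_apply (f + g) x = support_fun (f + g) C"
    by (rule support_fun_attained[OF C])
  have "blinfun_apply f x + blinfun_apply g x \<le> support_fun f C + support_fun g C"
    by (intro add_mono support_fun_upper[OF C(1) x(1)])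
  then show "support_fun (f + g) C \<le> support_fun f C + support_fun g C"
    using x(2) by (simp add: blinfun.add_left)
next
  show "support_fun 0 C = 0" using C(2) by (simp add: support_fun_def)
next
  fix c :: real and f :: "'b \<Rightarrow>\<^sub>L real" assume c: "c > 0"
  obtain x where x: "x \<in> C" "blinfun_apply (c *\<^sub>R f) x = support_fun (c *\<^sub>R f) C"
    by (rule support_fun_attained[OF C])
  have "c * blinfun_apply f x \<le> c * support_fun f C"
    using c by (intro mult_left_mono support_fun_upper[OF C(1) x(1)]) simp
  then show "support_fun (c *\<^sub>R f) C \<le> c * support_fun f C"
    using x(2) by (simp add: blinfun.scaleR_left)
qed

lemma dominated_linear_eq_blinfun:
  fixes \<phi> :: "'v::real_normed_vector \<Rightarrow> real"
  assumes \<phi>: "linear \<phi>" "\<And>v. \<phi> v \<le> c * norm v" and "c \<ge> 0"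
  obtains f :: "'v \<Rightarrow>\<^sub>L real" where "blinfun_apply f = \<phi>" "norm f \<le> c"
proof -
  have abs: "\<bar>\<phi> v\<bar> \<le> c * norm v" for v
    using \<phi>(2)[of v] \<phi>(2)[of "- v"] linear_neg[OF \<phi>(1), of v] by simp
  then have "\<exists>K. \<forall>v. norm (\<phi> v) \<le> norm v * K" by (auto simp: mult.commute)
  then have "bounded_linear \<phi>"
    using \<phi>(1) by (simp add: bounded_linear_def bounded_linear_axioms_def)
  then have f: "blinfun_apply (Blinfun \<phi>) = \<phi>" by (rule bounded_linear_Blinfun_apply)
  show ?thesis
    by (rule that[OF f]) (rule norm_blinfun_bound, use assms in \<open>simp_all add: f abs\<close>)
qed

lemma norm_le_if_functionals_le:
  fixes x :: "'b::real_normed_vector"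
  assumes "c \<ge> 0" "\<And>f :: 'b \<Rightarrow>\<^sub>L real. blinfun_apply f x \<le> c * norm f"
  shows "norm x \<le> c"
proof -
  have "sublinear (norm :: 'b \<Rightarrow> real)"
    by (rule sublinearI) (auto simp: norm_triangle_ineq)
  then obtain \<phi> where \<phi>: "linear \<phi>" "\<And>v. \<phi> v \<le> norm v" "\<phi> x = norm x"
    using hahn_banach_sublinear[of norm x] by metis
  obtain f where f: "blinfun_apply f = \<phi>" "norm f \<le> 1"
    using dominated_linear_eq_blinfun[of \<phi> 1] \<phi> by auto
  have "norm x = blinfun_apply f x" by (simp add: f \<phi>)
  also have "\<dots> \<le> c * norm f" by (rule assms(2))
  also have "\<dots> \<le> c" using \<open>norm f \<le> 1\<close> \<open>c \<ge> 0\<close> by (rule mult_left_le)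
  finally show ?thesis .
qed

text \<open>The uniform boundedness principle, from the Baire category theorem in the dual space, which is
  always complete. The Hahn-Banach theorem converts the bound on functionals into one
  on norms.\<close>

theorem weakly_bounded_imp_bounded:
  fixes W :: "'b::real_normed_vector set"
  assumes "\<And>f :: 'b \<Rightarrow>\<^sub>L real. bounded (blinfun_apply f ` W)"
  obtains R where "R > 0" "\<And>x. x \<in> W \<Longrightarrow> norm x \<le> R"
proof -
  define A where "A n = {f :: 'b \<Rightarrow>\<^sub>L real. \<forall>x\<in>W. \<bar>blinfun_apply f x\<bar> \<le> real n}" for n
  have "closed (A n)" for n
  proof -
    have "A n = (\<Inter>x\<in>W. {f. \<bar>blinfun_apply f x\<bar> \<le> real n})" by (auto simp: A_def)
    moreover have "closed {f :: 'b \<Rightarrow>\<^sub>L real. \<bar>blinfun_apply f x\<bar> \<le> real n}" for x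
      by (intro closed_Collect_le continuous_intros)
    ultimately show ?thesis by auto
  qed
  moreover have "\<Union>(range A) = UNIV"
  proof -
    have "\<exists>n. f \<in> A n" for f
    proof -
      obtain B where B: "\<And>x. x \<in> W \<Longrightarrow> \<bar>blinfun_apply f x\<bar> \<le> B"
        using assms[of f] by (auto simp: bounded_iff)
      obtain n where "B \<le> real n" using real_arch_simple by blast
      then have "f \<in> A n" using B by (auto simp: A_def intro: order_trans)
      then show ?thesis ..
    qed
    then show ?thesis by auto
  qed
  ultimately obtain n where n: "interior (A n) \<noteq> {}"
    using Met_TC.metric_Baire_category_alt[where ?'a = "'b \<Rightarrow>\<^sub>L real", of "range A"]
    by (auto simp: complete_UNIV)
  then obtain f0 e where e: "e > 0" "cball f0 e \<subseteq> A n"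
    by (metis all_not_in_conv interior_subset mem_interior_cball)
  have fx: "blinfun_apply f x \<le> (2 * real n / e) * norm f" if "x \<in> W" for x f
  proof (cases "f = 0")
    case False
    define g where "g = (e / norm f) *\<^sub>R f"
    have "f0 + g \<in> A n" "f0 \<in> A n" using e False by (auto simp: g_def dist_norm intro!: subsetD[OF e(2)])
    then have "\<bar>blinfun_apply (f0 + g) x\<bar> \<le> n" "\<bar>blinfun_apply f0 x\<bar> \<le> n"
      using that by (auto simp: A_def)
    then have "blinfun_apply g x \<le> 2 * n" by (simp add: blinfun.add_left)
    then show ?thesis using e False by (simp add: g_def blinfun.scaleR_left field_simps)
  qed simp
  show ?thesis
    by (rule that[of "2 * real n / e + 1"], use e in \<open>simp add: add_nonneg_pos\<close>)
      (use norm_le_if_functionals_le[OF _ fx] e in force)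
qed

text \<open>The weak topology need not be first countable, so a sequence in a weakly compact set has a cluster
  point that may not be the limit of any subsequence. Testing the cluster property against a single
  functional at a time is enough for the applications.\<close>

lemma weak_cluster_point:
  fixes W :: "'b::real_normed_vector set"
  assumes W: "compactin weak_topology W" and "\<And>n::nat. x n \<in> W"
  obtains y where "y \<in> W"
    "\<And>(f :: 'b \<Rightarrow>\<^sub>L real) d N. d > 0 \<Longrightarrow> \<exists>n\<ge>N. \<bar>blinfun_apply f (x n) - blinfun_apply f y\<bar> < d"
proof -
  let ?F = "filtermap (\<lambda>n. eval_at (x n)) sequentially"
  have "\<exists>\<psi>\<in>eval_at ` W. inf (nhds \<psi>) ?F \<noteq> bot"
    using W[unfolded weakly_compact_iff compact_filter, rule_format, of ?F] assms(2)
    by (simp add: eventually_filtermap filtermap_bot_iff)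
  then obtain y where y: "y \<in> W" "inf (nhds (eval_at y)) ?F \<noteq> bot" by blast
  have "\<exists>n\<ge>N. \<bar>blinfun_apply f (x n) - blinfun_apply f y\<bar> < d"
    if "d > 0" for f :: "'b \<Rightarrow>\<^sub>L real" and d N
  proof (rule ccontr)
    assume neg: "\<not> ?thesis"
    let ?U = "{\<psi>. \<bar>\<psi> f - blinfun_apply f y\<bar> < d}"
    have "open ?U"
      by (intro open_Collect_less continuous_on_rabs continuous_on_diff
          continuous_on_product_coordinates continuous_on_const)
    then have "eventually (\<lambda>\<psi>. \<psi> \<in> ?U) (nhds (eval_at y))"
      using that by (intro eventually_nhds_in_open) auto
    moreover have "eventually (\<lambda>\<psi>. \<psi> \<notin> ?U) ?F"
      using neg by (auto simp: eventually_filtermap eventually_sequentially)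
    ultimately have "eventually (\<lambda>_. False) (inf (nhds (eval_at y)) ?F)"
      unfolding eventually_inf
      by (intro exI[of _ "\<lambda>\<psi>. \<psi> \<in> ?U"] exI[of _ "\<lambda>\<psi>. \<psi> \<notin> ?U"]) auto
    with y(2) show False by (simp add: eventually_False)
  qed
  then show ?thesis by (rule that[OF y(1)])
qed

lemma weak_finite_net:
  fixes W :: "'b::real_normed_vector set" and d :: real
  assumes W: "compactin weak_topology W" and "finite G" "d > 0"
  obtains N where "finite N" "N \<subseteq> W"
    "\<And>w. w \<in> W \<Longrightarrow> \<exists>x\<in>N. \<forall>g\<in>G. \<bar>blinfun_apply g w - blinfun_apply g x\<bar> < d"
proof -
  let ?U = "\<lambda>x. {\<psi>. \<forall>g\<in>G. \<psi> g \<in> ball (blinfun_apply g x) d}"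
  have "open (?U x)" for x
    using \<open>finite G\<close> by (intro product_topology_basis'[where x="\<lambda>g. g"]) auto
  moreover have "eval_at ` W \<subseteq> (\<Union>x\<in>W. ?U x)" using \<open>d > 0\<close> by auto
  ultimately obtain N where N: "N \<subseteq> W" "finite N" "eval_at ` W \<subseteq> (\<Union>x\<in>N. ?U x)"
    by (rule compactE_image[OF W[unfolded weakly_compact_iff], of W ?U])
  show ?thesis
  proof (rule that[OF N(2,1)])
    fix w assume "w \<in> W"
    with N(3) obtain x where "x \<in> N" "eval_at w \<in> ?U x" by blast
    then show "\<exists>x\<in>N. \<forall>g\<in>G. \<bar>blinfun_apply g w - blinfun_apply g x\<bar> < d"
      by (intro bexI[of _ x]) (auto simp: dist_real_def abs_minus_commute)
  qed
qed

text \<open>The point \<open>(\<psi> g, \<psi> f)\<close> lies in the compact convex image of \<open>C\<close> under \<open>(g, f)\<close>, since otherwise a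
  line in the plane separates them and its normal vector gives a functional at which \<open>\<psi>\<close> exceeds the
  support function. So \<open>C\<close> may be cut down to a level set of one functional without losing domination.\<close>

lemma dominated_by_support_fun_level:
  fixes C :: "'b::real_normed_vector set"
  assumes C: "C \<in> cwk" and \<psi>: "linear \<psi>" "\<And>f. \<psi> f \<le> support_fun f C"
  shows "{x \<in> C. blinfun_apply g x = \<psi> g} \<in> cwk \<and>
    (\<forall>f. \<psi> f \<le> support_fun f {x \<in> C. blinfun_apply g x = \<psi> g})"
proof -
  let ?D = "{x \<in> C. blinfun_apply g x = \<psi> g}"
  have wk: "compactin weak_topology C" and cv: "convex C" and ne: "C \<noteq> {}"
    using C by (auto simp: cwk_def)
  have key: "\<exists>x\<in>?D. blinfun_apply f x = \<psi> f" for f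
  proof -
    let ?T = "\<lambda>x. (blinfun_apply g x, blinfun_apply f x)"
    have "compact ((\<lambda>\<psi>. (\<psi> g, \<psi> f)) ` eval_at ` C)"
      by (rule compact_continuous_image[OF continuous_on_subset[OF continuous_on_Pair[OF
        continuous_on_product_coordinates continuous_on_product_coordinates]]])
       (use wk in \<open>auto simp: weakly_compact_iff\<close>)
    then have "compact (?T ` C)" by (simp add: image_image)
    then have cl: "closed (?T ` C)" by (rule compact_imp_closed)
    have cvT: "convex (?T ` C)"
      by (rule convex_linear_image[OF _ cv])
        (auto intro!: linearI simp: blinfun.add_right blinfun.scaleR_right)
    have "(\<psi> g, \<psi> f) \<in> ?T ` C"
    proof (rule ccontr)
      assume "(\<psi> g, \<psi> f) \<notin> ?T ` C"
      from separating_hyperplane_closed_point[OF cvT cl this]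
      obtain a b where ab: "inner a (\<psi> g, \<psi> f) < b" "\<And>z. z \<in> ?T ` C \<Longrightarrow> inner a z > b" by blast
      obtain c d where a: "a = (c, d)" by (cases a)
      \<comment> \<open>\<open>a\<close> points from the separated point towards the image; a large value
         of \<open>\<psi>\<close> needs the opposite direction\<close>
      let ?h = "(- c) *\<^sub>R g + (- d) *\<^sub>R f"
      obtain x where x: "x \<in> C" "blinfun_apply ?h x = support_fun ?h C"
        by (rule support_fun_attained[OF wk ne])
      have "\<psi> ?h = - inner a (\<psi> g, \<psi> f)"
        using \<psi>(1) by (simp only: linear_add linear_scale a) (simp add: inner_prod_def)
      moreover have "blinfun_apply ?h x = - inner a (?T x)"
        by (simp add: a inner_prod_def blinfun.add_left blinfun.scaleR_left blinfun.minus_left blinfun.diff_left)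
      moreover have "inner a (?T x) > b" using ab(2) x(1) by blast
      ultimately show False using ab(1) \<psi>(2)[of ?h] x(2) by linarith
    qed
    then show ?thesis by auto
  qed
  have "?D \<in> cwk"
    unfolding cwk_def
  proof (intro CollectI conjI)
    show "?D \<noteq> {}" using key by blast
    have "?D = C \<inter> {x. blinfun_apply g x = \<psi> g}" by blast
    moreover have "convex {x. blinfun_apply g x = \<psi> g}"
      by (auto simp: convex_def blinfun.add_right blinfun.scaleR_right simp flip: distrib_right)
    ultimately show "convex ?D" using cv by (simp add: convex_Int)
    show "compactin weak_topology ?D" by (rule weakly_compact_level_set[OF wk])
  qed
  moreover have "\<psi> f \<le> support_fun f ?D" for f
  proof -
    obtain x where x: "x \<in> ?D" "blinfun_apply f x = \<psi> f" using key[of f] by blast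
    show ?thesis using support_fun_upper[OF weakly_compact_level_set[OF wk] x(1), of f] x(2) by simp
  qed
  ultimately show ?thesis by blast
qed

lemma dominated_by_support_fun_finite:
  fixes C :: "'b::real_normed_vector set"
  assumes "finite F" "C \<in> cwk" and \<psi>: "linear \<psi>" and "\<And>f. \<psi> f \<le> support_fun f C"
  shows "\<exists>x\<in>C. \<forall>f\<in>F. blinfun_apply f x = \<psi> f"
  using assms(1,2,4)
proof (induction F arbitrary: C rule: finite_induct)
  case empty
  then show ?case by (auto simp: cwk_def)
next
  case (insert g F)
  let ?D = "{x \<in> C. blinfun_apply g x = \<psi> g}"
  have "?D \<in> cwk" "\<And>f. \<psi> f \<le> support_fun f ?D"
    using dominated_by_support_fun_level[OF insert.prems(1) \<psi> insert.prems(2)] by auto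
  from insert.IH[OF this] show ?case by auto
qed

text \<open>A member of \<open>cwk\<close> is recovered from its support function even inside the space of all linear functionals
  on the dual: cutting with finitely many level sets leaves a nonempty set, and compactness handles all
  functionals at once.\<close>

theorem dominated_by_support_fun_imp_eval:
  fixes C :: "'b::real_normed_vector set"
  assumes C: "C \<in> cwk" and \<psi>: "linear \<psi>" "\<And>f. \<psi> f \<le> support_fun f C"
  obtains x where "x \<in> C" "\<psi> = eval_at x"
proof -
  have "eval_at ` C \<inter> (\<Inter>f\<in>UNIV. {\<xi>. \<xi> f = \<psi> f}) \<noteq> {}"
  proof (rule compact_imp_fip_image)
    show "compact (eval_at ` C)" using C by (simp add: cwk_def weakly_compact_iff)
    show "closed {\<xi>. \<xi> f = \<psi> f}" for f
      by (intro closed_Collect_eq continuous_on_product_coordinates continuous_on_const)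
    fix F :: "('b \<Rightarrow>\<^sub>L real) set" assume "finite F"
    then show "eval_at ` C \<inter> (\<Inter>f\<in>F. {\<xi>. \<xi> f = \<psi> f}) \<noteq> {}"
      using dominated_by_support_fun_finite[OF \<open>finite F\<close> C \<psi>] by fastforce
  qed
  then obtain x where "x \<in> C" "\<forall>f. blinfun_apply f x = \<psi> f" by auto
  then show ?thesis by (intro that[of x]) auto
qed

section \<open>Functionals dominated by a weakly compact set\<close>

lemma abs_blinfun_le:
  fixes f :: "'b::real_normed_vector \<Rightarrow>\<^sub>L real"
  shows "\<bar>blinfun_apply f x\<bar> \<le> norm f * norm x"
  using norm_blinfun[of f x] by simp

lemma support_fun_bound:
  fixes W :: "'b::real_normed_vector set"
  assumes W: "compactin weak_topology W" "W \<noteq> {}"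
  obtains R where "R > 0" "\<And>f. \<bar>support_fun f W\<bar> \<le> R * norm f"
proof -
  obtain R where R: "R > 0" "\<And>x. x \<in> W \<Longrightarrow> norm x \<le> R"
    using weakly_bounded_imp_bounded[OF compact_imp_bounded[OF weakly_compact_image[OF W(1)]]] by metis
  have "\<bar>support_fun f W\<bar> \<le> R * norm f" for f
  proof -
    obtain x where x: "x \<in> W" "blinfun_apply f x = support_fun f W"
      by (rule support_fun_attained[OF W])
    have "\<bar>blinfun_apply f x\<bar> \<le> norm f * norm x" by (rule abs_blinfun_le)
    also have "\<dots> \<le> norm f * R" using R(2)[OF x(1)] by (intro mult_left_mono) auto
    finally show ?thesis by (simp add: x(2) mult.commute)
  qed
  then show ?thesis by (rule that[OF R(1)])
qed

text \<open>Simons' inequality in the case of limit superior at most zero. It replaces the representation of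
  functionals on \<open>C(W)\<close> by measures in the classical proof that a pointwise null sequence on a weakly
  compact set has uniformly small convex combinations.

  Suppose all limits of convex combinations of the \<open>f n\<close> have supremum above \<open>e\<close> on
  \<open>W\<close>. Choose \<open>g n\<close> in the closed convex hull
  \<open>C n\<close> of the tail so that it nearly minimizes the supremum of \<open>h n + 2 * (1/2)^n *\<^sub>R g n\<close>, where \<open>h n\<close> is
  the partial sum of \<open>(1/2)^k *\<^sub>R g k\<close>. The full sum \<open>H\<close> is \<open>h n + 2 * (1/2)^n *\<^sub>R t n\<close> with \<open>t n\<close> in
  \<open>C n\<close>, so it competes in each of these minimizations. At a point \<open>w\<close> where \<open>H\<close> attains its supremum this
  bounds \<open>h n\<close> from above, hence every \<open>t n\<close> from below by \<open>e / 2\<close>, although \<open>t n\<close> is a limit of convex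
  combinations of \<open>f k\<close> with \<open>k \<ge> n\<close>, which are eventually small at \<open>w\<close>.\<close>

theorem simons_inequality:
  fixes W :: "'b::real_normed_vector set" and f :: "nat \<Rightarrow> 'b \<Rightarrow>\<^sub>L real"
  assumes W: "compactin weak_topology W" "W \<noteq> {}"
    and f1: "\<And>n. norm (f n) \<le> 1"
    and lim: "\<And>w e. w \<in> W \<Longrightarrow> e > 0 \<Longrightarrow> eventually (\<lambda>n. blinfun_apply (f n) w \<le> e) sequentially"
    and e: "e > 0"
  shows "\<exists>g \<in> closure (convex hull (range f)). support_fun g W \<le> e"
proof (rule ccontr)
  define S where "S = (\<lambda>g. support_fun g W)"
  define C where "C n = closure (convex hull (f ` {n..}))" for n
  assume "\<not> ?thesis"
  then have big: "S g > e" if "g \<in> C 0" for g using that by (auto simp: C_def S_def not_le atLeast_0)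
  have Sub: "sublinear S" unfolding S_def by (rule sublinear_support_fun[OF W])
  have cvx: "convex (C n)" and clo: "closed (C n)" for n
    by (simp_all add: C_def convex_closure)
  have anti: "C n \<subseteq> C k" if "k \<le> n" for k n
    unfolding C_def using that by (intro closure_mono hull_mono image_mono) auto
  have C_le: "C n \<subseteq> H" if "closed H" "convex H" "\<And>k. k \<ge> n \<Longrightarrow> f k \<in> H" for n H
    unfolding C_def using that by (intro closure_minimal hull_minimal) auto
  have "C 0 \<subseteq> cball 0 1" by (rule C_le) (simp_all add: f1)
  then have C1: "norm g \<le> 1" if "g \<in> C n" for g n using that anti[of 0 n] by auto
  have fC: "f n \<in> C n" for n
    unfolding C_def by (rule subsetD[OF closure_subset], rule hull_inc) simp
  obtain R where R: "\<And>g. \<bar>S g\<bar> \<le> R * norm g" "R > 0"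
    unfolding S_def by (rule support_fun_bound[OF W]) blast
  \<comment> \<open>the factor \<open>(1/4)^n\<close> leaves summable errors after multiplication by \<open>2^n\<close> below\<close>
  define \<delta> where "\<delta> n = e / 2 * (1/4)^n" for n :: nat
  have \<delta>0: "\<delta> n > 0" for n using e by (simp add: \<delta>_def)
  have "\<exists>g\<in>C n. \<forall>g'\<in>C n. S (h + (2 * (1/2)^n) *\<^sub>R g) \<le> S (h + (2 * (1/2)^n) *\<^sub>R g') + \<delta> n" for n h
  proof -
    let ?T = "(\<lambda>g. S (h + (2 * (1/2)^n) *\<^sub>R g)) ` C n"
    have bdd: "bdd_below ?T"
    proof (rule bdd_belowI2)
      fix g assume g: "g \<in> C n"
      have "norm (h + (2 * (1/2)^n) *\<^sub>R g) \<le> norm h + norm ((2 * (1/2)^n) *\<^sub>R g)"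
        by (rule norm_triangle_ineq)
      also have "norm ((2 * (1/2)^n) *\<^sub>R g) \<le> 2 * 1"
        unfolding norm_scaleR using C1[OF g] by (intro mult_mono) (auto simp: power_le_one)
      finally have "R * norm (h + (2 * (1/2)^n) *\<^sub>R g) \<le> R * (norm h + 2)"
        using R(2) by (intro mult_left_mono) auto
      then show "- (R * (norm h + 2)) \<le> S (h + (2 * (1/2)^n) *\<^sub>R g)"
        using R(1)[of "h + (2 * (1/2)^n) *\<^sub>R g"] by linarith
    qed
    have "?T \<noteq> {}" using fC by blast
    moreover have "Inf ?T < Inf ?T + \<delta> n" using \<delta>0 by simp
    ultimately have "\<exists>s\<in>?T. s < Inf ?T + \<delta> n" by (rule cInf_lessD)
    then obtain g where g: "g \<in> C n" "S (h + (2 * (1/2)^n) *\<^sub>R g) < Inf ?T + \<delta> n" by blast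
    have "S (h + (2 * (1/2)^n) *\<^sub>R g) \<le> S (h + (2 * (1/2)^n) *\<^sub>R g') + \<delta> n" if "g' \<in> C n" for g'
      using g(2) cInf_lower[OF imageI[OF that] bdd] by linarith
    with g(1) show ?thesis by blast
  qed
  then obtain G where G: "\<And>n h. G n h \<in> C n"
    "\<And>n h g'. g' \<in> C n \<Longrightarrow> S (h + (2 * (1/2)^n) *\<^sub>R G n h) \<le> S (h + (2 * (1/2)^n) *\<^sub>R g') + \<delta> n"
    by metis
  define h where "h = rec_nat 0 (\<lambda>n h. h + (1/2)^n *\<^sub>R G n h)"
  have h0: "h 0 = 0" and hS: "h (Suc n) = h n + (1/2)^n *\<^sub>R G n (h n)" for n by (simp_all add: h_def)
  define g where "g n = G n (h n)" for n
  have gC: "g n \<in> C n" for n unfolding g_def by (rule G)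
  have h_sum: "h n = (\<Sum>k<n. (1/2)^k *\<^sub>R g k)" for n
    by (induction n) (simp_all add: h0 hS g_def)
  have "summable (\<lambda>k. (1/2)^k *\<^sub>R g k)"
  proof (rule summable_comparison_test')
    show "summable (\<lambda>k. (1/2 :: real)^k)" by (simp add: summable_geometric)
    show "norm ((1/2)^k *\<^sub>R g k) \<le> (1/2)^k" for k
      using C1[OF gC[of k]] by (simp add: mult_left_le)
  qed
  then have "convergent h" unfolding h_sum[abs_def] by (simp add: summable_iff_convergent)
  then obtain H where H: "h \<longlonglongrightarrow> H" by (auto simp: convergent_def)
  \<comment> \<open>\<open>t n\<close> is the convex combination of \<open>g k\<close>, \<open>k \<ge> n\<close>, with weights \<open>(1/2)^(k - n + 1)\<close>\<close>
  define t where "t n = (2^n / 2) *\<^sub>R (H - h n)" for n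
  \<comment> \<open>finite versions of \<open>t n\<close>, made into convex combinations by giving the missing weight to the last term\<close>
  have y: "(2^n / 2) *\<^sub>R (h (n + j) - h n) + (1/2)^j *\<^sub>R g (n + j) \<in> C n" for n j
  proof (induction j arbitrary: n)
    case 0
    then show ?case using gC by simp
  next
    case (Suc j)
    let ?y = "(2^Suc n / 2) *\<^sub>R (h (Suc n + j) - h (Suc n)) + (1/2)^j *\<^sub>R g (Suc n + j)"
    have "?y \<in> C n" using Suc.IH[of "Suc n"] anti[of n "Suc n"] by auto
    then have "(1/2) *\<^sub>R g n + (1/2) *\<^sub>R ?y \<in> C n"
      using convexD[OF cvx gC, of ?y n "1/2" "1/2"] by simp
    also have "(1/2) *\<^sub>R g n + (1/2) *\<^sub>R ?y
        = (2^n / 2) *\<^sub>R (h (n + Suc j) - h n) + (1/2)^Suc j *\<^sub>R g (n + Suc j)"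
    proof -
      have "(2^n / 2) *\<^sub>R (h (Suc n + j) - h n)
          = (2^n / 2) *\<^sub>R (h (Suc n + j) - h (Suc n)) + (2^n / 2) *\<^sub>R ((1/2)^n *\<^sub>R g n)"
        by (simp add: hS g_def algebra_simps)
      also have "(2^n / 2) *\<^sub>R ((1/2)^n *\<^sub>R g n) = (1/2) *\<^sub>R g n"
        by (simp add: power_divide)
      finally show ?thesis by (simp add: algebra_simps)
    qed
    finally show ?case .
  qed
  have tC: "t n \<in> C n" for n
  proof (rule closed_sequentially[OF clo y])
    have "(\<lambda>j. (1/2)^j *\<^sub>R g (n + j)) \<longlonglongrightarrow> 0"
    proof (rule Lim_null_comparison)
      show "\<forall>\<^sub>F j in sequentially. norm ((1/2)^j *\<^sub>R g (n + j)) \<le> (1/2)^j"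
        using C1[OF gC] by (intro always_eventually) (auto simp: mult_left_le)
      show "(\<lambda>j. (1/2 :: real)^j) \<longlonglongrightarrow> 0" by (rule LIMSEQ_power_zero) simp
    qed
    moreover have "(\<lambda>j. h (n + j)) \<longlonglongrightarrow> H"
      using LIMSEQ_ignore_initial_segment[OF H, of n] by (simp add: add.commute)
    ultimately have "(\<lambda>j. (2^n / 2) *\<^sub>R (h (n + j) - h n) + (1/2)^j *\<^sub>R g (n + j))
        \<longlonglongrightarrow> (2^n / 2) *\<^sub>R (H - h n) + 0"
      by (intro tendsto_add tendsto_scaleR tendsto_diff tendsto_const)
    then show "(\<lambda>j. (2^n / 2) *\<^sub>R (h (n + j) - h n) + (1/2)^j *\<^sub>R g (n + j)) \<longlonglongrightarrow> t n"
      by (simp add: t_def)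
  qed
  have H_eq: "H = h n + (2 * (1/2)^n) *\<^sub>R t n" for n
    by (simp add: t_def power_divide)
  obtain w where w: "w \<in> W" "blinfun_apply H w = S H"
    unfolding S_def by (rule support_fun_attained[OF W])
  have S_ge: "blinfun_apply v w \<le> S v" for v
    unfolding S_def by (rule support_fun_upper[OF W(1) w(1)])
  have D: "2^n * (S H - blinfun_apply (h n) w) \<ge> S H - e * (1 - (1/2)^n)" for n
  proof (induction n)
    case 0
    then show ?case by (simp add: h0)
  next
    case (Suc n)
    let ?u = "h n + (2 * (1/2)^n) *\<^sub>R g n"
    have "blinfun_apply ?u w \<le> S ?u" by (rule S_ge)
    also have "\<dots> \<le> S (h n + (2 * (1/2)^n) *\<^sub>R t n) + \<delta> n"
      unfolding g_def by (rule G(2)[OF tC])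
    also have "\<dots> = S H + \<delta> n" by (simp flip: H_eq)
    finally have u: "blinfun_apply ?u w \<le> S H + \<delta> n" .
    have "2 * blinfun_apply (h (Suc n)) w = blinfun_apply (h n) w + blinfun_apply ?u w"
      by (simp add: hS g_def blinfun.add_left blinfun.scaleR_left)
    then have "2 * (S H - blinfun_apply (h (Suc n)) w) \<ge> (S H - blinfun_apply (h n) w) - \<delta> n"
      using u by (simp add: algebra_simps)
    then have "2^n * (2 * (S H - blinfun_apply (h (Suc n)) w))
        \<ge> 2^n * ((S H - blinfun_apply (h n) w) - \<delta> n)"
      by (intro mult_left_mono) auto
    moreover have "2^n * \<delta> n = e / 2 * (1/2)^n" by (simp add: \<delta>_def flip: power_mult_distrib)
    ultimately have "2^Suc n * (S H - blinfun_apply (h (Suc n)) w)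
        \<ge> S H - e * (1 - (1/2)^n) - e / 2 * (1/2)^n"
      using Suc.IH right_diff_distrib[of "2^n" "S H - blinfun_apply (h n) w" "\<delta> n"]
      unfolding power_Suc2 mult.assoc
      by linarith
    also have "S H - e * (1 - (1/2)^n) - e / 2 * (1/2)^n = S H - e * (1 - (1/2)^Suc n)"
      by (simp add: field_simps)
    finally show ?case by simp
  qed
  have "S H = 2 * S (t 0)"
    using H_eq[of 0] sublinear_scale[OF Sub, of 2 "t 0"] by (simp add: h0)
  then have SH: "S H > 2 * e" using big[OF tC] by simp
  have tw: "blinfun_apply (t n) w > e / 2" for n
  proof -
    have "blinfun_apply (t n) w = 2^n * (S H - blinfun_apply (h n) w) / 2"
      by (simp add: t_def blinfun.scaleR_left blinfun.diff_left w(2))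
    moreover have "e * (1 - (1/2)^n) \<le> e * 1" using e by (intro mult_left_mono) auto
    ultimately show ?thesis using D[of n] SH by simp
  qed
  obtain N where N: "\<And>k. k \<ge> N \<Longrightarrow> blinfun_apply (f k) w \<le> e / 2"
    using lim[OF w(1), of "e/2"] e by (auto simp: eventually_sequentially)
  have "C N \<subseteq> {v. blinfun_apply v w \<le> e / 2}"
  proof (rule C_le)
    show "closed {v. blinfun_apply v w \<le> e / 2}"
      by (intro closed_Collect_le continuous_intros)
    show "convex {v :: 'b \<Rightarrow>\<^sub>L real. blinfun_apply v w \<le> e / 2}"
    proof (rule convexI, clarify)
      fix a b :: real and x y :: "'b \<Rightarrow>\<^sub>L real"
      assume *: "blinfun_apply x w \<le> e/2" "blinfun_apply y w \<le> e/2" "a \<ge> 0" "b \<ge> 0" "a + b = 1"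
      have "a * blinfun_apply x w + b * blinfun_apply y w \<le> e/2"
        using * by (intro convex_bound_le) auto
      then show "blinfun_apply (a *\<^sub>R x + b *\<^sub>R y) w \<le> e/2"
        by (simp add: blinfun.add_left blinfun.scaleR_left)
    qed
  qed (use N in auto)
  then show False using tC[of N] tw[of N] by auto
qed

lemma abs_blinfun_le_norm:
  fixes f :: "'b::real_normed_vector \<Rightarrow>\<^sub>L real"
  assumes "norm f \<le> 1"
  shows "\<bar>blinfun_apply f x\<bar> \<le> norm x"
  using abs_blinfun_le[of f x] mult_right_mono[OF assms, of "norm x"] by simp

text \<open>The limit superior of \<open>f n u\<close>, as an infimum of eventual upper bounds; for a bounded sequence of
  functionals it is real, so the extended reals are avoided.\<close>

definition limsup_functional :: "(nat \<Rightarrow> 'b::real_normed_vector \<Rightarrow>\<^sub>L real) \<Rightarrow> 'b \<Rightarrow> real"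
  where "limsup_functional f u = Inf {c. eventually (\<lambda>n. blinfun_apply (f n) u \<le> c) sequentially}"

lemma limsup_functional_le:
  assumes f1: "\<And>n. norm (f n) \<le> 1" and ev: "eventually (\<lambda>n. blinfun_apply (f n) u \<le> c) sequentially"
  shows "limsup_functional f u \<le> c"
  unfolding limsup_functional_def
proof (rule cInf_lower)
  show "bdd_below {c. eventually (\<lambda>n. blinfun_apply (f n) u \<le> c) sequentially}"
  proof (rule bdd_belowI, clarify)
    fix c assume "eventually (\<lambda>n. blinfun_apply (f n) u \<le> c) sequentially"
    then obtain n where "blinfun_apply (f n) u \<le> c" by (auto simp: eventually_sequentially)
    moreover have "\<bar>blinfun_apply (f n) u\<bar> \<le> norm u" by (rule abs_blinfun_le_norm[OF f1])
    ultimately show "- norm u \<le> c" by linarith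
  qed
qed (use ev in simp)

lemma limsup_functional_le_norm:
  assumes f1: "\<And>n. norm (f n) \<le> 1"
  shows "limsup_functional f u \<le> norm u"
  using abs_le_D1[OF abs_blinfun_le_norm[OF f1]] by (intro limsup_functional_le f1 always_eventually) blast

lemma eventually_le_limsup_functional:
  assumes f1: "\<And>n. norm (f n) \<le> 1" and c: "limsup_functional f u < c"
  shows "eventually (\<lambda>n. blinfun_apply (f n) u \<le> c) sequentially"
proof -
  have "eventually (\<lambda>n. blinfun_apply (f n) u \<le> norm u) sequentially"
    using abs_le_D1[OF abs_blinfun_le_norm[OF f1]] by (intro always_eventually) blast
  then have "{c. eventually (\<lambda>n. blinfun_apply (f n) u \<le> c) sequentially} \<noteq> {}" by blast
  from cInf_lessD[OF this c[unfolded limsup_functional_def]]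
  obtain d where "eventually (\<lambda>n. blinfun_apply (f n) u \<le> d) sequentially" "d < c" by blast
  then show ?thesis by (auto elim: eventually_mono)
qed

lemma sublinear_limsup_functional:
  assumes f1: "\<And>n. norm (f n) \<le> 1"
  shows "sublinear (limsup_functional f)"
proof (rule sublinearI)
  fix u v
  show "limsup_functional f (u + v) \<le> limsup_functional f u + limsup_functional f v"
  proof (rule field_le_epsilon)
    fix e :: real assume e: "e > 0"
    have "eventually (\<lambda>n. blinfun_apply (f n) u \<le> limsup_functional f u + e/2) sequentially"
      "eventually (\<lambda>n. blinfun_apply (f n) v \<le> limsup_functional f v + e/2) sequentially"
      using e by (auto intro!: eventually_le_limsup_functional[OF f1])
    then have "eventually (\<lambda>n. blinfun_apply (f n) (u + v)
        \<le> limsup_functional f u + limsup_functional f v + e) sequentially"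
      by eventually_elim (simp add: blinfun.add_right)
    then show "limsup_functional f (u + v) \<le> limsup_functional f u + limsup_functional f v + e"
      by (rule limsup_functional_le[OF f1])
  qed
next
  have "limsup_functional f 0 \<le> 0" by (rule limsup_functional_le[OF f1]) simp
  moreover have "\<not> limsup_functional f 0 < 0"
  proof
    assume a: "limsup_functional f 0 < 0"
    then obtain c where "limsup_functional f 0 < c" "c < 0" using dense by blast
    from eventually_le_limsup_functional[OF f1 this(1)] this(2) show False by simp
  qed
  ultimately show "limsup_functional f 0 = 0" by simp
next
  fix c :: real and u assume c: "c > 0"
  have "limsup_functional f (c *\<^sub>R u) / c \<le> limsup_functional f u"
  proof (rule field_le_epsilon)
    fix e :: real assume e: "e > 0"
    have "eventually (\<lambda>n. blinfun_apply (f n) u \<le> limsup_functional f u + e) sequentially"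
      using e by (auto intro!: eventually_le_limsup_functional[OF f1])
    then have "eventually (\<lambda>n. blinfun_apply (f n) (c *\<^sub>R u) \<le> c * (limsup_functional f u + e)) sequentially"
      by eventually_elim (use c in \<open>simp add: blinfun.scaleR_right\<close>)
    then have "limsup_functional f (c *\<^sub>R u) \<le> c * (limsup_functional f u + e)"
      by (rule limsup_functional_le[OF f1])
    then show "limsup_functional f (c *\<^sub>R u) / c \<le> limsup_functional f u + e"
      using c by (simp add: field_simps)
  qed
  then show "limsup_functional f (c *\<^sub>R u) \<le> c * limsup_functional f u" using c by (simp add: field_simps)
qed

text \<open>Modulo a linear combination of finitely many points, domination on their common annihilator is as good
  as domination everywhere. The points are removed one by one: the coefficient \<open>a\<close> of \<open>x\<close> has to lie
  between two families of numbers, as in the one-dimensional step of the Hahn-Banach theorem.\<close>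

lemma dominated_on_annihilator:
  fixes F :: "'b::real_normed_vector set" and q :: "('b \<Rightarrow>\<^sub>L real) \<Rightarrow> real"
  assumes "finite F" and q: "sublinear q"
    and "linear \<phi>" "\<And>f. \<forall>x\<in>F. blinfun_apply f x = 0 \<Longrightarrow> \<phi> f \<le> q f"
  shows "\<exists>y. \<forall>f. \<phi> f - blinfun_apply f y \<le> q f"
  using assms(1,3,4)
proof (induction F arbitrary: \<phi> rule: finite_induct)
  case empty
  then show ?case by (intro exI[of _ 0]) simp
next
  case (insert x F \<phi>)
  define A where "A = {\<phi> u - q u | u. (\<forall>z\<in>F. blinfun_apply u z = 0) \<and> blinfun_apply u x = 1}"
  define a where "a = Sup A"
  have upper: "\<phi> u - q u \<le> q v - \<phi> v"
    if "\<forall>z\<in>F. blinfun_apply u z = 0" "blinfun_apply u x = 1"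
      "\<forall>z\<in>F. blinfun_apply v z = 0" "blinfun_apply v x = - 1" for u v
  proof -
    have "\<phi> (u + v) \<le> q (u + v)"
      using that by (intro insert.prems(2)) (auto simp: blinfun.add_left)
    then show ?thesis
      using sublinear_add[OF q, of u v] linear_add[OF insert.prems(1), of u v] by simp
  qed
  have le_a: "\<phi> u - q u \<le> a"
    if u: "\<forall>z\<in>F. blinfun_apply u z = 0" "blinfun_apply u x = 1" for u
  proof -
    have "\<phi> u' - q u' \<le> q (- u) - \<phi> (- u)"
      if "\<forall>z\<in>F. blinfun_apply u' z = 0" "blinfun_apply u' x = 1" for u'
      using that u by (intro upper) (auto simp: blinfun.minus_left)
    then have "bdd_above A" unfolding A_def by (intro bdd_aboveI) blast
    then show ?thesis unfolding a_def using u by (intro cSup_upper) (auto simp: A_def)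
  qed
  have a_le: "a \<le> q v - \<phi> v"
    if v: "\<forall>z\<in>F. blinfun_apply v z = 0" "blinfun_apply v x = - 1" for v
  proof -
    have "\<phi> (- v) - q (- v) \<in> A"
      using v by (auto simp: A_def blinfun.minus_left intro!: exI[of _ "- v"])
    then show ?thesis unfolding a_def using upper v by (intro cSup_least) (auto simp: A_def)
  qed
  define \<phi>' where "\<phi>' f = \<phi> f - blinfun_apply f (a *\<^sub>R x)" for f
  have lin': "linear \<phi>'"
    by (rule linearI) (simp_all add: \<phi>'_def linear_add[OF insert.prems(1)] linear_scale[OF insert.prems(1)]
      blinfun.add_left blinfun.scaleR_left algebra_simps)
  have "\<phi>' f \<le> q f" if f: "\<forall>z\<in>F. blinfun_apply f z = 0" for f
  proof -
    let ?r = "blinfun_apply f x"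
    consider "?r = 0" | "?r > 0" | "?r < 0" by linarith
    then show ?thesis
    proof cases
      case 1
      then have "\<phi> f \<le> q f" using f by (intro insert.prems(2)) auto
      then show ?thesis using 1 by (simp add: \<phi>'_def blinfun.scaleR_right)
    next
      case 2
      let ?u = "(1 / ?r) *\<^sub>R f"
      have "\<phi> ?u - q ?u \<le> a" using f 2 by (intro le_a) (auto simp: blinfun.scaleR_left)
      moreover have "\<phi> ?u = \<phi> f / ?r" using linear_scale[OF insert.prems(1), of "1 / ?r" f] by simp
      moreover have "q ?u = q f / ?r" using 2 sublinear_scale[OF q, of "1 / ?r" f] by simp
      ultimately have "(\<phi> f - q f) / ?r \<le> a" by (simp add: diff_divide_distrib)
      then show ?thesis using 2 by (simp add: \<phi>'_def blinfun.scaleR_right field_simps)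
    next
      case 3
      let ?u = "(1 / - ?r) *\<^sub>R f"
      have "a \<le> q ?u - \<phi> ?u" using f 3 by (intro a_le) (auto simp: blinfun.scaleR_left blinfun.minus_left)
      moreover have "\<phi> ?u = \<phi> f / - ?r" using linear_scale[OF insert.prems(1), of "1 / - ?r" f] by simp
      moreover have "q ?u = q f / - ?r" using 3 sublinear_scale[OF q, of "1 / - ?r" f] by simp
      ultimately have "a \<le> (q f - \<phi> f) / - ?r" by (simp only: diff_divide_distrib)
      then have "a * - ?r \<le> q f - \<phi> f" using 3 by (subst (asm) pos_le_divide_eq) auto
      then show ?thesis by (simp add: \<phi>'_def blinfun.scaleR_right)
    qed
  qed
  from insert.IH[OF lin' this] obtain y where y: "\<forall>f. \<phi>' f - blinfun_apply f y \<le> q f" by blast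
  show ?case
    by (intro exI[of _ "a *\<^sub>R x + y"]) (use y in \<open>auto simp: \<phi>'_def blinfun.add_right algebra_simps\<close>)
qed

text \<open>For \<open>w\<close> in \<open>W\<close> take approximants \<open>x n\<close> from the nets and a weak cluster point \<open>y\<close> of them. All \<open>f i\<close>
  agree at \<open>w\<close> and \<open>y\<close>, so \<open>w\<close> may be replaced by \<open>y\<close>. At each \<open>x n\<close> the sequence is eventually zero.
  To carry this over to \<open>y\<close>, a functional that is dominated by the limit superior and agrees with it at
  \<open>y\<close> is bounded and vanishes at every \<open>x n\<close>, hence at the cluster point \<open>y\<close>. The construction is that of
  Whitley's proof of the Eberlein-Smulian theorem, with the roles of the space and its dual exchanged.\<close>

lemma weak_null_on_compact:
  fixes W :: "'b::real_normed_vector set" and f :: "nat \<Rightarrow> 'b \<Rightarrow>\<^sub>L real"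
  assumes W: "compactin weak_topology W"
    and f1: "\<And>n. norm (f n) \<le> 1"
    and van: "\<And>n k x. x \<in> F n \<Longrightarrow> n < k \<Longrightarrow> blinfun_apply (f k) x = 0"
    and net: "\<And>n w. w \<in> W \<Longrightarrow>
      \<exists>x\<in>F n \<inter> W. \<forall>i\<le>n. \<bar>blinfun_apply (f i) w - blinfun_apply (f i) x\<bar> < 1 / real (Suc n)"
    and w: "w \<in> W" and e: "e > 0"
  shows "eventually (\<lambda>n. blinfun_apply (f n) w \<le> e) sequentially"
proof -
  have "\<forall>n. \<exists>x. x \<in> F n \<inter> W \<and> (\<forall>i\<le>n. \<bar>blinfun_apply (f i) w - blinfun_apply (f i) x\<bar> < 1 / real (Suc n))"
    using net[OF w] by blast
  then obtain x where x: "\<And>n. x n \<in> F n" "\<And>n. x n \<in> W"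
    "\<And>n i. i \<le> n \<Longrightarrow> \<bar>blinfun_apply (f i) w - blinfun_apply (f i) (x n)\<bar> < 1 / real (Suc n)"
    by (metis IntE)
  obtain y where y: "y \<in> W"
    and cl: "\<And>(g :: 'b \<Rightarrow>\<^sub>L real) d N. d > 0 \<Longrightarrow> \<exists>n\<ge>N. \<bar>blinfun_apply g (x n) - blinfun_apply g y\<bar> < d"
    by (rule weak_cluster_point[OF W, of x, OF x(2)]) blast
  have same: "blinfun_apply (f i) w = blinfun_apply (f i) y" for i
  proof (rule ccontr)
    assume "\<not> ?thesis"
    then have d: "\<bar>blinfun_apply (f i) w - blinfun_apply (f i) y\<bar> > 0" (is "?d > 0") by simp
    obtain N where N: "1 / real (Suc N) < ?d / 2" using d nat_approx_posE[of "?d / 2"] by (metis half_gt_zero)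
    obtain n where n: "n \<ge> max N i" "\<bar>blinfun_apply (f i) (x n) - blinfun_apply (f i) y\<bar> < ?d / 2"
      using cl[of "?d / 2" "max N i" "f i"] d by auto
    have "1 / real (Suc n) \<le> 1 / real (Suc N)" using n(1) by (simp add: field_simps)
    moreover have "\<bar>blinfun_apply (f i) w - blinfun_apply (f i) (x n)\<bar> < 1 / real (Suc n)"
      using n(1) by (intro x(3)) simp
    ultimately have "\<bar>blinfun_apply (f i) w - blinfun_apply (f i) (x n)\<bar> < ?d / 2"
      using N by linarith
    then show False using n(2) by (simp add: abs_if split: if_splits)
  qed
  let ?P = "limsup_functional f"
  obtain \<phi> where \<phi>: "linear \<phi>" "\<And>v. \<phi> v \<le> ?P v" "\<phi> y = ?P y"
    by (rule hahn_banach_sublinear[OF sublinear_limsup_functional[of f, OF f1], of y]) blast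
  have "\<phi> v \<le> 1 * norm v" for v
    using order_trans[OF \<phi>(2) limsup_functional_le_norm[of f v, OF f1]] by simp
  then obtain g where g: "blinfun_apply g = \<phi>"
    using dominated_linear_eq_blinfun[OF \<phi>(1), of 1] by auto
  have ev0: "\<forall>\<^sub>F k in sequentially. blinfun_apply (f k) (x n) = 0" for n
    using van[OF x(1)] by (auto simp: eventually_sequentially intro!: exI[of _ "Suc n"])
  have "\<phi> (x n) = 0" for n
  proof -
    have "?P (x n) \<le> 0"
      by (rule limsup_functional_le[OF f1]) (use ev0[of n] in \<open>auto elim: eventually_mono\<close>)
    moreover have "?P (- x n) \<le> 0"
      by (rule limsup_functional_le[OF f1])
        (use ev0[of n] in \<open>auto elim: eventually_mono simp: blinfun.minus_right\<close>)
    ultimately show ?thesis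
      using \<phi>(2)[of "x n"] \<phi>(2)[of "- x n"] linear_neg[OF \<phi>(1), of "x n"] by simp
  qed
  then have "\<bar>?P y\<bar> < d" if "d > 0" for d
    using cl[OF that, of 0 g] by (simp add: g \<phi>(3))
  then have "?P y < e" using e by (meson abs_ge_self le_less_trans)
  from eventually_le_limsup_functional[of f, OF f1 this] show ?thesis by (simp add: same)
qed

text \<open>If some finite set of points controls \<open>\<phi>\<close> up to \<open>2 * e * norm f\<close> on its annihilator, then
  \<open>dominated_on_annihilator\<close> gives the point. Otherwise a sequence of functionals is built together with
  finite nets of \<open>W\<close>, as required by \<open>weak_null_on_compact\<close>, and Simons' inequality yields a functional
  with small supremum on \<open>W\<close> while \<open>\<phi>\<close> is at least \<open>2 * e\<close> on it.\<close>

theorem krein_approximation: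
  fixes W :: "'b::real_normed_vector set" and \<phi> :: "('b \<Rightarrow>\<^sub>L real) \<Rightarrow> real"
  assumes W: "compactin weak_topology W" "W \<noteq> {}"
    and \<phi>: "linear \<phi>" and c: "c \<ge> 0" and e: "e > 0"
    and le: "\<And>f. \<phi> f \<le> c * max 0 (support_fun f W) + e * norm f"
  shows "\<exists>x. \<forall>f. \<bar>\<phi> f - blinfun_apply f x\<bar> \<le> 2 * e * norm f"
proof -
  have "\<exists>F. finite F \<and> (\<forall>f. (\<forall>x\<in>F. blinfun_apply f x = 0) \<longrightarrow> \<phi> f \<le> 2 * e * norm f)"
  proof (rule ccontr)
    assume neg: "\<not> ?thesis"
    have pick: "\<exists>f. norm f \<le> 1 \<and> (\<forall>x\<in>F. blinfun_apply f x = 0) \<and> \<phi> f \<ge> 2 * e" if "finite F" for F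
    proof -
      obtain f where f: "\<forall>x\<in>F. blinfun_apply f x = 0" "\<phi> f > 2 * e * norm f"
        using neg \<open>finite F\<close> by (auto simp: not_le)
      then have "f \<noteq> 0" using linear_0[OF \<phi>] by auto
      then show ?thesis
        using f by (intro exI[of _ "(1 / norm f) *\<^sub>R f"])
          (auto simp: blinfun.scaleR_left linear_scale[OF \<phi>] field_simps)
    qed
    \<comment> \<open>A state consists of the current functional, all functionals so far, and all net points so far.\<close>
    define I where "I n s \<longleftrightarrow> (case s of (f, G, F) \<Rightarrow> finite G \<and> finite F \<and> f \<in> G \<and> norm f \<le> 1 \<and> \<phi> f \<ge> 2 * e \<and>
      (\<forall>w\<in>W. \<exists>x\<in>F \<inter> W. \<forall>g\<in>G. \<bar>blinfun_apply g w - blinfun_apply g x\<bar> < 1 / real (Suc n)))"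
      for n and s :: "('b \<Rightarrow>\<^sub>L real) \<times> ('b \<Rightarrow>\<^sub>L real) set \<times> 'b set"
    define T where "T s s' \<longleftrightarrow> (case s of (f, G, F) \<Rightarrow> case s' of (f', G', F') \<Rightarrow>
      G \<subseteq> G' \<and> F \<subseteq> F' \<and> (\<forall>x\<in>F. blinfun_apply f' x = 0))"
      for s s' :: "('b \<Rightarrow>\<^sub>L real) \<times> ('b \<Rightarrow>\<^sub>L real) set \<times> 'b set"
    have next_state: "\<exists>s. I n s \<and> T (f0, G, F) s" if "finite G" "finite F" for n f0 G F
    proof -
      obtain f where f: "norm f \<le> 1" "\<forall>x\<in>F. blinfun_apply f x = 0" "\<phi> f \<ge> 2 * e"
        using pick[OF \<open>finite F\<close>] by blast
      obtain N where N: "finite N" "N \<subseteq> W"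
        "\<And>w. w \<in> W \<Longrightarrow> \<exists>x\<in>N. \<forall>g\<in>insert f G. \<bar>blinfun_apply g w - blinfun_apply g x\<bar> < 1 / real (Suc n)"
        using weak_finite_net[OF W(1), of "insert f G" "1 / real (Suc n)"] \<open>finite G\<close> by auto
      have "\<exists>x\<in>(F \<union> N) \<inter> W. \<forall>g\<in>insert f G. \<bar>blinfun_apply g w - blinfun_apply g x\<bar> < 1 / real (Suc n)"
        if "w \<in> W" for w
        using N(3)[OF that] N(2) by blast
      then have "I n (f, insert f G, F \<union> N)" using f N(1) that by (simp add: I_def)
      moreover have "T (f0, G, F) (f, insert f G, F \<union> N)" using f by (auto simp: T_def)
      ultimately show ?thesis by blast
    qed
    have "\<exists>s. \<forall>n. I n (s n) \<and> T (s n) (s (Suc n))"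
    proof (rule dependent_nat_choice)
      show "\<exists>s. I 0 s" using next_state[of "{}" "{}"] by blast
      show "\<exists>s'. I (Suc n) s' \<and> T s s'" if "I n s" for s n
        using that next_state[of "fst (snd s)" "snd (snd s)" "Suc n" "fst s"]
        by (cases s) (simp add: I_def)
    qed
    then obtain s where s: "\<And>n. I n (s n)" "\<And>n. T (s n) (s (Suc n))" by blast
    define f where "f n = fst (s n)" for n
    define G where "G n = fst (snd (s n))" for n
    define F where "F n = snd (snd (s n))" for n
    have s_eq: "s n = (f n, G n, F n)" for n by (simp add: f_def G_def F_def)
    have I: "f n \<in> G n" "norm (f n) \<le> 1" "\<phi> (f n) \<ge> 2 * e"
      "\<And>w. w \<in> W \<Longrightarrow> \<exists>x\<in>F n \<inter> W. \<forall>g\<in>G n. \<bar>blinfun_apply g w - blinfun_apply g x\<bar> < 1 / real (Suc n)" for n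
      using s(1)[of n] by (auto simp: I_def s_eq)
    have T: "G n \<subseteq> G (Suc n)" "F n \<subseteq> F (Suc n)" "\<And>x. x \<in> F n \<Longrightarrow> blinfun_apply (f (Suc n)) x = 0" for n
      using s(2)[of n] by (auto simp: T_def s_eq)
    have G_mono: "G i \<subseteq> G n" if "i \<le> n" for i n by (rule lift_Suc_mono_le[of G, OF T(1) that])
    have F_mono: "F i \<subseteq> F n" if "i \<le> n" for i n by (rule lift_Suc_mono_le[of F, OF T(2) that])
    have van: "blinfun_apply (f k) x = 0" if "x \<in> F n" "n < k" for x n k
    proof -
      obtain j where j: "k = Suc j" "n \<le> j" using \<open>n < k\<close> by (cases k) auto
      then show ?thesis using T(3)[of x j] F_mono[OF j(2)] that(1) by auto
    qed
    have net: "\<exists>x\<in>F n \<inter> W. \<forall>i\<le>n. \<bar>blinfun_apply (f i) w - blinfun_apply (f i) x\<bar> < 1 / real (Suc n)"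
      if "w \<in> W" for n w
      using I(4)[OF that, of n] G_mono I(1) by blast
    have null: "eventually (\<lambda>n. blinfun_apply (f n) w \<le> d) sequentially" if "w \<in> W" "d > 0" for w d
      using weak_null_on_compact[OF W(1) I(2) van net that] .
    \<comment> \<open>This gives \<open>c * d + e < 2 * e\<close>, which contradicts the lower bound for \<open>\<phi>\<close>.\<close>
    define d where "d = e / 2 / (c + 1)"
    have "c + 1 > 0" using c by simp
    then have "d > 0" using e by (simp add: d_def)
    moreover have "d * (c + 1) = e / 2"
      using \<open>c + 1 > 0\<close> unfolding d_def by (intro nonzero_eq_divide_eq[THEN iffD1]) auto
    ultimately have d: "d > 0" "c * d < e" using e by (simp_all add: algebra_simps)
    obtain g where g: "g \<in> closure (convex hull (range f))" "support_fun g W \<le> d"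
      using simons_inequality[OF W I(2) null d(1)] by blast
    obtain R where R: "R > 0" "\<And>f. \<bar>support_fun f W\<bar> \<le> R * norm f"
      by (rule support_fun_bound[OF W]) blast
    have "\<phi> v \<le> (c * R + e) * norm v" for v
    proof -
      have "max 0 (support_fun v W) \<le> R * norm v" using R(2)[of v] by linarith
      then have "c * max 0 (support_fun v W) \<le> c * (R * norm v)" using c by (intro mult_left_mono)
      then show ?thesis using le[of v] by (simp add: algebra_simps)
    qed
    moreover have "c * R + e \<ge> 0" using c R(1) e by simp
    ultimately obtain \<Phi> where \<Phi>: "blinfun_apply \<Phi> = \<phi>"
      using dominated_linear_eq_blinfun[OF \<phi>] by blast
    have "closure (convex hull (range f)) \<subseteq> {v. blinfun_apply \<Phi> v \<ge> 2 * e} \<inter> cball 0 1"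
    proof (intro closure_minimal hull_minimal)
      show "range f \<subseteq> {v. blinfun_apply \<Phi> v \<ge> 2 * e} \<inter> cball 0 1" using I by (auto simp: \<Phi>)
      have "convex (blinfun_apply \<Phi> -` {2 * e..})"
        by (rule convex_linear_vimage) (auto intro!: linearI simp: blinfun.add_right blinfun.scaleR_right)
      then have "convex {v. blinfun_apply \<Phi> v \<ge> 2 * e}" by (simp add: vimage_def)
      then show "convex ({v. blinfun_apply \<Phi> v \<ge> 2 * e} \<inter> cball 0 1)" by (intro convex_Int) auto
      show "closed ({v. blinfun_apply \<Phi> v \<ge> 2 * e} \<inter> cball 0 1)"
        by (intro closed_Int closed_Collect_le continuous_intros closed_cball)
    qed
    then have "\<phi> g \<ge> 2 * e" "norm g \<le> 1" using g(1) by (auto simp: \<Phi>)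
    have "c * max 0 (support_fun g W) \<le> c * d" using c d(1) g(2) by (intro mult_left_mono) auto
    moreover have "e * norm g \<le> e" using \<open>norm g \<le> 1\<close> e by (simp add: mult_left_le)
    ultimately show False using le[of g] \<open>\<phi> g \<ge> 2 * e\<close> d(2) by linarith
  qed
  then obtain F where F: "finite F" "\<And>f. \<forall>x\<in>F. blinfun_apply f x = 0 \<Longrightarrow> \<phi> f \<le> 2 * e * norm f" by blast
  have "sublinear (\<lambda>f :: 'b \<Rightarrow>\<^sub>L real. 2 * e * norm f)"
  proof (rule sublinearI)
    fix u v :: "'b \<Rightarrow>\<^sub>L real"
    have "2 * e * norm (u + v) \<le> 2 * e * (norm u + norm v)"
      using e by (intro mult_left_mono norm_triangle_ineq) simp
    then show "2 * e * norm (u + v) \<le> 2 * e * norm u + 2 * e * norm v" by (simp add: algebra_simps)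
  qed auto
  from dominated_on_annihilator[OF F(1) this \<phi> F(2)]
  obtain x where x: "\<And>f. \<phi> f - blinfun_apply f x \<le> 2 * e * norm f" by blast
  have "\<bar>\<phi> f - blinfun_apply f x\<bar> \<le> 2 * e * norm f" for f
    using x[of f] x[of "- f"] linear_neg[OF \<phi>, of f] by (simp add: blinfun.minus_left abs_le_iff)
  then show ?thesis by blast
qed

text \<open>The approximating points form a Cauchy sequence because the norm is the supremum over functionals; here
  completeness of the space enters.\<close>

theorem eval_if_nearly_dominated:
  fixes \<phi> :: "('b::banach \<Rightarrow>\<^sub>L real) \<Rightarrow> real"
  assumes \<phi>: "linear \<phi>"
    and dom: "\<And>e. e > 0 \<Longrightarrow> \<exists>W c. compactin weak_topology W \<and> W \<noteq> {} \<and> c \<ge> 0 \<and>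
      (\<forall>f. \<phi> f \<le> c * max 0 (support_fun f W) + e * norm f)"
  obtains x where "\<phi> = eval_at x"
proof -
  have "\<exists>x. \<forall>f. \<bar>\<phi> f - blinfun_apply f x\<bar> \<le> e * norm f" if e: "e > 0" for e
  proof -
    obtain W c where "compactin weak_topology W" "W \<noteq> {}" "c \<ge> 0"
      "\<And>f. \<phi> f \<le> c * max 0 (support_fun f W) + e / 2 * norm f"
      using dom[of "e / 2"] e by auto
    from krein_approximation[OF this(1,2) \<phi> this(3) _ this(4)] e show ?thesis by auto
  qed
  then have "\<forall>n. \<exists>x. \<forall>f. \<bar>\<phi> f - blinfun_apply f x\<bar> \<le> (1/2)^n * norm f" by simp
  then obtain x where x: "\<And>n f. \<bar>\<phi> f - blinfun_apply f (x n)\<bar> \<le> (1/2)^n * norm f" by metis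
  have "norm (x m - x n) \<le> (1/2)^m + (1/2)^n" for m n
  proof (rule norm_le_if_functionals_le)
    fix f
    show "blinfun_apply f (x m - x n) \<le> ((1/2)^m + (1/2)^n) * norm f"
      using x[of f m] x[of f n] by (simp add: blinfun.diff_right distrib_right abs_le_iff)
  qed simp
  then have "Cauchy x"
  proof -
    assume b: "\<And>m n. norm (x m - x n) \<le> (1/2)^m + (1/2)^n"
    show ?thesis
    proof (rule CauchyI)
      fix e :: real assume "e > 0"
      then obtain N where N: "(1/2)^N < e / 2" using real_arch_pow_inv[of "e/2" "1/2"] by auto
      have "norm (x m - x n) < e" if "m \<ge> N" "n \<ge> N" for m n
        using b[of m n] N power_decreasing[OF that(1), of "1/2::real"] power_decreasing[OF that(2), of "1/2::real"]
        by linarith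
      then show "\<exists>M. \<forall>m\<ge>M. \<forall>n\<ge>M. norm (x m - x n) < e" by blast
    qed
  qed
  then obtain y where y: "x \<longlonglongrightarrow> y" using Cauchy_convergent convergent_def by blast
  have "\<phi> f = blinfun_apply f y" for f
  proof -
    have "(\<lambda>n. \<phi> f - blinfun_apply f (x n)) \<longlonglongrightarrow> 0"
    proof (rule Lim_null_comparison)
      show "\<forall>\<^sub>F n in sequentially. norm (\<phi> f - blinfun_apply f (x n)) \<le> (1/2)^n * norm f"
        using x by (intro always_eventually) auto
      show "(\<lambda>n. (1/2)^n * norm f) \<longlonglongrightarrow> 0"
        by (intro tendsto_mult_left_zero LIMSEQ_power_zero) simp
    qed
    moreover have "(\<lambda>n. \<phi> f - blinfun_apply f (x n)) \<longlonglongrightarrow> \<phi> f - blinfun_apply f y"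
      by (intro tendsto_diff tendsto_const blinfun.tendsto[OF tendsto_const y])
    ultimately show ?thesis using LIMSEQ_unique by force
  qed
  then show ?thesis by (intro that[of y]) auto
qed

section \<open>Weakly compact ranges and sets with a prescribed support function\<close>

lemma cwkD:
  assumes "C \<in> cwk"
  shows "compactin weak_topology C" "C \<noteq> {}" "convex C"
  using assms by (auto simp: cwk_def)

lemma closed_linear_functionals:
  "closed {\<psi> :: 'v::real_vector \<Rightarrow> real. linear \<psi>}"
proof -
  have eq: "{\<psi> :: 'v \<Rightarrow> real. linear \<psi>} =
      (\<Inter>u. \<Inter>v. {\<psi>. \<psi> (u + v) = \<psi> u + \<psi> v}) \<inter> (\<Inter>c. \<Inter>u. {\<psi>. \<psi> (c *\<^sub>R u) = c * \<psi> u})"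
    by (auto simp: linear_iff)
  show ?thesis
    unfolding eq
    by (intro closed_Int closed_INT ballI closed_Collect_eq continuous_on_add continuous_on_mult
        continuous_on_product_coordinates continuous_on_const)
qed

lemma compact_box:
  fixes a b :: "'i \<Rightarrow> real"
  shows "compact {\<psi>. \<forall>i. a i \<le> \<psi> i \<and> \<psi> i \<le> b i}"
proof -
  have "compactin (product_topology (\<lambda>i. euclidean) UNIV) (PiE UNIV (\<lambda>i. {a i..b i}))"
    by (subst compactin_PiE) auto
  moreover have "PiE UNIV (\<lambda>i. {a i..b i}) = {\<psi>. \<forall>i. a i \<le> \<psi> i \<and> \<psi> i \<le> b i}" by auto
  ultimately show ?thesis by (simp add: euclidean_product_topology)
qed

text \<open>By \<open>dominated_by_support_fun_imp_eval\<close> the union is the projection of the set of all pairs \<open>(t, \<psi>)\<close> with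
  \<open>t \<in> K\<close> and \<open>\<psi>\<close> linear and below the support function of \<open>\<Gamma> t\<close>. Scalar continuity makes these
  conditions closed in the product of \<open>K\<close> with a compact box.\<close>

lemma weakly_compact_UN:
  fixes \<Gamma> :: "'a::t2_space \<Rightarrow> 'b::real_normed_vector set"
  assumes \<Gamma>: "\<And>t. \<Gamma> t \<in> cwk" and cont: "scalarly_continuous \<Gamma>" and K: "compact K"
  shows "compactin weak_topology (\<Union>t\<in>K. \<Gamma> t)"
proof -
  have c: "continuous_on UNIV (\<lambda>t. support_fun f (\<Gamma> t))" for f
    using cont by (simp add: scalarly_continuous_def)
  have "\<exists>b. \<forall>t\<in>K. support_fun f (\<Gamma> t) \<le> b" for f
  proof -
    have "compact ((\<lambda>t. support_fun f (\<Gamma> t)) ` K)"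
      by (rule compact_continuous_image[OF continuous_on_subset[OF c] K]) simp
    then have "bdd_above ((\<lambda>t. support_fun f (\<Gamma> t)) ` K)"
      by (intro bounded_imp_bdd_above compact_imp_bounded)
    then show ?thesis by (auto simp: bdd_above_def)
  qed
  then obtain b where b: "\<And>f t. t \<in> K \<Longrightarrow> support_fun f (\<Gamma> t) \<le> b f" by metis
  define B where "B = {\<psi>. \<forall>f. - b (- f) \<le> \<psi> f \<and> \<psi> f \<le> b f}"
  define L where "L = (UNIV :: 'a set) \<times> {\<psi> :: ('b \<Rightarrow>\<^sub>L real) \<Rightarrow> real. linear \<psi>}"
  define D where "D = (\<Inter>f. {p :: 'a \<times> (('b \<Rightarrow>\<^sub>L real) \<Rightarrow> real). snd p f \<le> support_fun f (\<Gamma> (fst p))})"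
  have "closed L" unfolding L_def by (intro closed_Times closed_UNIV closed_linear_functionals)
  moreover have "closed D"
    unfolding D_def
  proof (intro closed_INT ballI closed_Collect_le)
    fix f
    show "continuous_on UNIV (\<lambda>p :: 'a \<times> (('b \<Rightarrow>\<^sub>L real) \<Rightarrow> real). snd p f)"
      by (rule continuous_on_compose2[OF continuous_on_product_coordinates continuous_on_snd]) auto
    show "continuous_on UNIV (\<lambda>p :: 'a \<times> (('b \<Rightarrow>\<^sub>L real) \<Rightarrow> real). support_fun f (\<Gamma> (fst p)))"
      by (rule continuous_on_compose2[OF c continuous_on_fst]) auto
  qed
  moreover have "compact (K \<times> B)" unfolding B_def by (intro compact_Times K compact_box)
  ultimately have "compact ((K \<times> B) \<inter> (L \<inter> D))" by (intro compact_Int_closed closed_Int)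
  then have "compact (snd ` ((K \<times> B) \<inter> (L \<inter> D)))"
    by (intro compact_continuous_image) (auto intro: continuous_intros)
  also have "snd ` ((K \<times> B) \<inter> (L \<inter> D)) = eval_at ` (\<Union>t\<in>K. \<Gamma> t)"
  proof (intro subset_antisym subsetI)
    fix \<psi> assume "\<psi> \<in> snd ` ((K \<times> B) \<inter> (L \<inter> D))"
    then obtain t where t: "t \<in> K" "linear \<psi>" "\<And>f. \<psi> f \<le> support_fun f (\<Gamma> t)"
      by (auto simp: L_def D_def)
    obtain x where "x \<in> \<Gamma> t" "\<psi> = eval_at x"
      by (rule dominated_by_support_fun_imp_eval[OF \<Gamma> t(2,3)])
    with t(1) show "\<psi> \<in> eval_at ` (\<Union>t\<in>K. \<Gamma> t)" by blast
  next
    fix \<psi> assume "\<psi> \<in> eval_at ` (\<Union>t\<in>K. \<Gamma> t)"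
    then obtain t x where t: "t \<in> K" "x \<in> \<Gamma> t" "\<psi> = eval_at x" by blast
    have up: "blinfun_apply f x \<le> support_fun f (\<Gamma> t)" for f
      by (rule support_fun_upper[OF cwkD(1)[OF \<Gamma>] t(2)])
    have "- b (- f) \<le> \<psi> f \<and> \<psi> f \<le> b f" for f
      using up[of f] up[of "- f"] b[OF t(1), of f] b[OF t(1), of "- f"]
      by (simp add: t(3) blinfun.minus_left)
    moreover have "linear \<psi>"
      unfolding t(3) by (rule linearI) (simp_all add: blinfun.add_left blinfun.scaleR_left)
    ultimately have "(t, \<psi>) \<in> (K \<times> B) \<inter> (L \<inter> D)"
      using t(1) up by (auto simp: B_def L_def D_def t(3))
    then show "\<psi> \<in> snd ` ((K \<times> B) \<inter> (L \<inter> D))" by force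
  qed
  finally show ?thesis by (simp add: weakly_compact_iff)
qed

text \<open>The linear functionals below \<open>p\<close> form a closed subset of a compact box, so if all of them are evaluations
  then the corresponding set of points is weakly compact. Hahn-Banach shows that \<open>p\<close> is its support
  function.\<close>

lemma ex_cwk_support_fun:
  fixes p :: "('b::real_normed_vector \<Rightarrow>\<^sub>L real) \<Rightarrow> real"
  assumes p: "sublinear p"
    and ev: "\<And>\<phi>. linear \<phi> \<Longrightarrow> (\<And>f. \<phi> f \<le> p f) \<Longrightarrow> \<exists>x. \<phi> = eval_at x"
  shows "\<exists>C\<in>cwk. \<forall>f. support_fun f C = p f"
proof -
  define C where "C = {x. \<forall>f. blinfun_apply f x \<le> p f}"
  have lin: "linear (eval_at x)" for x :: 'b
    by (rule linearI) (simp_all add: blinfun.add_left blinfun.scaleR_left)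
  have ex: "\<exists>x\<in>C. blinfun_apply f x = p f" for f
  proof -
    obtain \<phi> where \<phi>: "linear \<phi>" "\<And>g. \<phi> g \<le> p g" "\<phi> f = p f"
      by (rule hahn_banach_sublinear[OF p, of f]) blast
    then obtain x where "\<phi> = eval_at x" using ev by blast
    then show ?thesis using \<phi> by (auto simp: C_def)
  qed
  have "eval_at ` C = {\<psi>. linear \<psi>} \<inter> (\<Inter>f. {\<psi>. \<psi> f \<le> p f}) \<inter> {\<psi>. \<forall>f. - p (- f) \<le> \<psi> f \<and> \<psi> f \<le> p f}"
  proof (intro subset_antisym subsetI)
    fix \<psi> assume "\<psi> \<in> eval_at ` C"
    then obtain x where x: "\<psi> = eval_at x" "\<And>f. blinfun_apply f x \<le> p f" by (auto simp: C_def)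
    have "- p (- f) \<le> blinfun_apply f x" for f using x(2)[of "- f"] by (simp add: blinfun.minus_left)
    then show "\<psi> \<in> {\<psi>. linear \<psi>} \<inter> (\<Inter>f. {\<psi>. \<psi> f \<le> p f}) \<inter> {\<psi>. \<forall>f. - p (- f) \<le> \<psi> f \<and> \<psi> f \<le> p f}"
      using x lin by auto
  next
    fix \<psi> assume "\<psi> \<in> {\<psi>. linear \<psi>} \<inter> (\<Inter>f. {\<psi>. \<psi> f \<le> p f}) \<inter> {\<psi>. \<forall>f. - p (- f) \<le> \<psi> f \<and> \<psi> f \<le> p f}"
    then have \<psi>: "linear \<psi>" "\<And>f. \<psi> f \<le> p f" by auto
    then obtain x where "\<psi> = eval_at x" using ev by blast
    then show "\<psi> \<in> eval_at ` C" using \<psi>(2) by (auto simp: C_def)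
  qed
  moreover have "compact ({\<psi>. \<forall>f. - p (- f) \<le> \<psi> f \<and> \<psi> f \<le> p f} \<inter> ({\<psi>. linear \<psi>} \<inter> (\<Inter>f. {\<psi>. \<psi> f \<le> p f})))"
    by (intro compact_Int_closed compact_box closed_Int closed_linear_functionals closed_INT ballI
        closed_Collect_le continuous_on_product_coordinates continuous_on_const)
  ultimately have wk: "compactin weak_topology C" by (simp add: weakly_compact_iff Int_commute)
  have "convex C"
  proof (rule convexI)
    fix x y and u v :: real assume *: "x \<in> C" "y \<in> C" "u \<ge> 0" "v \<ge> 0" "u + v = 1"
    have "u * blinfun_apply f x + v * blinfun_apply f y \<le> p f" for f
      using * by (intro convex_bound_le) (auto simp: C_def)
    then show "u *\<^sub>R x + v *\<^sub>R y \<in> C" by (simp add: C_def blinfun.add_right blinfun.scaleR_right)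
  qed
  moreover have ne: "C \<noteq> {}" using ex by blast
  moreover have "support_fun f C = p f" for f
  proof (rule antisym)
    obtain x where "x \<in> C" "blinfun_apply f x = support_fun f C" by (rule support_fun_attained[OF wk ne])
    then show "support_fun f C \<le> p f" unfolding C_def by (metis mem_Collect_eq)
    show "p f \<le> support_fun f C" using ex[of f] support_fun_upper[OF wk] by metis
  qed
  ultimately show ?thesis using wk by (auto simp: cwk_def)
qed

section \<open>From vague to setwise convergence\<close>

lemma finite_borel_measuresD:
  assumes "m \<in> finite_borel_measures"
  shows "finite_measure m" "sets m = sets borel" "space m = UNIV"
  using assms sets_eq_imp_space_eq[of m borel] by (auto simp: finite_borel_measures_def)

lemma radon_inner_approx:
  fixes m :: "'a::t2_space measure"
  assumes m: "m \<in> finite_borel_measures" "radon m" and A: "A \<in> sets borel" and d: "d > 0"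
  obtains K where "compact K" "K \<subseteq> A" "measure m (A - K) < d"
proof -
  interpret finite_measure m by (rule finite_borel_measuresD[OF m(1)])
  note sb[simp] = finite_borel_measuresD(2)[OF m(1)]
  have K_sets: "K \<in> sets borel" if "compact K" for K :: "'a set" using that by (simp add: compact_imp_closed)
  have "\<exists>K. compact K \<and> K \<subseteq> A \<and> measure m A - d < measure m K"
  proof (cases "measure m A < d")
    case True
    then show ?thesis by (intro exI[of _ "{}"]) simp
  next
    case False
    have "ennreal (measure m A - d) < emeasure m A"
      unfolding emeasure_eq_measure using d False by (intro ennreal_lessI) linarith+
    also have "emeasure m A = (SUP K\<in>{K. compact K \<and> K \<subseteq> A}. emeasure m K)"
      using m(2) A by (simp add: radon_def)
    finally obtain K where "compact K" "K \<subseteq> A" "ennreal (measure m A - d) < emeasure m K"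
      by (auto simp: less_SUP_iff)
    then show ?thesis using False by (auto simp: emeasure_eq_measure ennreal_less_iff)
  qed
  then obtain K where K: "compact K" "K \<subseteq> A" "measure m A - d < measure m K" by blast
  moreover have "measure m (A - K) = measure m A - measure m K"
    using K A K_sets by (intro finite_measure_Diff) auto
  ultimately show ?thesis using that by auto
qed

text \<open>The Urysohn function vanishes off \<open>U \<inter> V\<close> for a relatively compact open \<open>V\<close>, so it vanishes at infinity.\<close>

lemma urysohn_C0:
  fixes K U :: "'a::t2_space set"
  assumes lc: "locally_compact_space (euclidean :: 'a topology)"
    and K: "compact K" and U: "open U" "K \<subseteq> U"
  obtains g where "g \<in> C0_functions" "\<And>t. 0 \<le> g t \<and> g t \<le> 1"
    "\<And>t. t \<in> K \<Longrightarrow> g t = 1" "\<And>t. t \<notin> U \<Longrightarrow> g t = (0::real)"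
proof -
  have H: "Hausdorff_space (euclidean :: 'a topology)"
    unfolding Hausdorff_space_def using hausdorff by (auto simp: disjnt_def)
  have "\<exists>V L. openin (euclidean :: 'a topology) V \<and> compactin euclidean L \<and> closedin euclidean L \<and> K \<subseteq> V \<and> V \<subseteq> L"
    using locally_compact_space_compact_closed_compact[of "euclidean :: 'a topology"] H lc K by auto
  then obtain V L where V: "open V" "compact L" "K \<subseteq> V" "V \<subseteq> L" by auto
  have cr: "completely_regular_space (euclidean :: 'a topology)"
    using locally_compact_regular_imp_completely_regular_space[OF lc] H by blast
  obtain g :: "'a \<Rightarrow> real" where g: "continuous_map euclidean (top_of_set {0..1}) g"
    "g ` (- (U \<inter> V)) \<subseteq> {0}" "g ` K \<subseteq> {1}"
    by (rule Urysohn_completely_regular_compact_closed[of 0 1 "euclidean :: 'a topology" K "- (U \<inter> V)"])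
      (use U V K cr in \<open>auto simp: disjnt_iff\<close>)
  have gc: "continuous_on UNIV g" and g01: "0 \<le> g t \<and> g t \<le> 1" for t
    using g(1) by (auto simp: continuous_map_in_subtopology)
  have "g \<in> C0_functions"
    unfolding C0_functions_def
  proof (intro CollectI conjI gc allI impI)
    fix e :: real assume "e > 0"
    then show "\<exists>K. compact K \<and> (\<forall>t. t \<notin> K \<longrightarrow> \<bar>g t\<bar> < e)"
      using V g(2) by (intro exI[of _ L]) force
  qed
  then show ?thesis using g g01 by (intro that[of g]) auto
qed

lemma unif_abs_continuousD:
  assumes u: "unif_abs_continuous ms m" and m: "m \<in> finite_borel_measures"
    and ms: "\<And>n. ms n \<in> finite_borel_measures" and e: "e > 0"
  obtains d where "d > 0" "\<And>E n. E \<in> sets borel \<Longrightarrow> measure m E < d \<Longrightarrow> measure (ms n) E < e"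
proof -
  interpret finite_measure m by (rule finite_borel_measuresD[OF m])
  obtain d where d: "d > 0"
    "\<And>E. E \<in> sets borel \<Longrightarrow> emeasure m E < ennreal d \<Longrightarrow> (SUP n. emeasure (ms n) E) < ennreal e"
    using u e unfolding unif_abs_continuous_def by metis
  show ?thesis
  proof (rule that[OF d(1)])
    fix E n assume E: "E \<in> sets borel" "measure m E < d"
    interpret n: finite_measure "ms n" by (rule finite_borel_measuresD[OF ms])
    have "emeasure (ms n) E \<le> (SUP n. emeasure (ms n) E)" by (rule SUP_upper) simp
    also have "\<dots> < ennreal e"
      using E by (intro d(2)) (simp_all add: emeasure_eq_measure ennreal_less_iff)
    finally show "measure (ms n) E < e" by (simp add: n.emeasure_eq_measure ennreal_less_iff)
  qed
qed

text \<open>Inner regularity of \<open>A\<close> and of its complement provides compact \<open>K \<subseteq> A\<close> and open \<open>- L \<supseteq> A\<close> whose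
  difference is small for \<open>m\<close> and, by uniform absolute continuity, for all \<open>ms n\<close>. Any function between
  the indicators of \<open>K\<close> and \<open>- L\<close> approximates the indicator of \<open>A\<close> in mean for all the measures at once.\<close>

theorem vague_imp_setwise:
  fixes m :: "'a::t2_space measure"
  assumes lc: "locally_compact_space (euclidean :: 'a topology)"
    and m: "m \<in> finite_borel_measures" "radon m" and ms: "\<And>n. ms n \<in> finite_borel_measures"
    and v: "vaguely_converges ms m" and u: "unif_abs_continuous ms m"
    and A: "A \<in> sets borel"
  shows "(\<lambda>n. measure (ms n) A) \<longlonglongrightarrow> measure m A"
proof (rule LIMSEQ_I)
  fix e :: real assume e: "e > 0"
  obtain d0 where d0: "d0 > 0" "\<And>E n. E \<in> sets borel \<Longrightarrow> measure m E < d0 \<Longrightarrow> measure (ms n) E < e / 3"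
    using unif_abs_continuousD[OF u m(1) ms, of "e / 3"] e by auto
  define d where "d = min d0 (e / 3)"
  have d: "d > 0" using d0 e by (simp add: d_def)
  have K_sets: "K \<in> sets borel" if "compact K" for K :: "'a set" using that by (simp add: compact_imp_closed)
  obtain K where K: "compact K" "K \<subseteq> A" "measure m (A - K) < d / 2"
    using radon_inner_approx[OF m A, of "d/2"] d by auto
  obtain L where L: "compact L" "L \<subseteq> - A" "measure m (- A - L) < d / 2"
    using radon_inner_approx[OF m, of "- A" "d/2"] A d by auto
  obtain g where g: "g \<in> C0_functions" "\<And>t. 0 \<le> g t \<and> g t \<le> 1"
    "\<And>t. t \<in> K \<Longrightarrow> g t = 1" "\<And>t. t \<notin> - L \<Longrightarrow> g t = (0::real)"
    using urysohn_C0[OF lc K(1), of "- L"] L K by (metis compact_imp_closed open_Compl Compl_anti_mono order_trans double_compl)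
  let ?E = "(A - K) \<union> (- A - L)"
  have E: "?E \<in> sets borel" using A K_sets[OF K(1)] K_sets[OF L(1)] by auto
  have g_meas: "g \<in> borel_measurable borel"
    using g(1) by (intro borel_measurable_continuous_onI) (simp add: C0_functions_def)
  have close: "\<bar>measure \<mu> A - (LINT t|\<mu>. g t)\<bar> \<le> measure \<mu> ?E" if \<mu>: "\<mu> \<in> finite_borel_measures" for \<mu>
  proof -
    interpret finite_measure \<mu> by (rule finite_borel_measuresD[OF \<mu>])
    note [simp] = finite_borel_measuresD(2,3)[OF \<mu>] measurable_cong_sets[OF finite_borel_measuresD(2)[OF \<mu>] refl]
    have i1: "integrable \<mu> (indicator A :: 'a \<Rightarrow> real)" "integrable \<mu> (indicator ?E :: 'a \<Rightarrow> real)"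
      using A E by (auto simp: emeasure_eq_measure)
    have i2: "integrable \<mu> g"
      by (rule integrable_const_bound[of _ 1]) (use g(2) g_meas in auto)
    have "measure \<mu> A - (LINT t|\<mu>. g t) = (LINT t|\<mu>. indicator A t - g t)"
      using i1 i2 A by simp
    also have "\<bar>\<dots>\<bar> \<le> (LINT t|\<mu>. \<bar>indicator A t - g t\<bar>)" by (rule integral_abs_bound)
    also have "\<dots> \<le> (LINT t|\<mu>. indicator ?E t)"
    proof (rule integral_mono)
      fix t
      show "\<bar>indicator A t - g t\<bar> \<le> indicator ?E t"
        using g(2)[of t] g(3)[of t] g(4)[of t] K(2) L(2) by (auto simp: indicator_def abs_le_iff)
    qed (use i1 i2 in auto)
    also have "\<dots> = measure \<mu> ?E" using E by simp
    finally show ?thesis .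
  qed
  have mE: "measure m ?E < d"
  proof -
    interpret finite_measure m by (rule finite_borel_measuresD[OF m(1)])
    have "measure m ?E \<le> measure m (A - K) + measure m (- A - L)"
      using A K_sets[OF K(1)] K_sets[OF L(1)] finite_borel_measuresD(2)[OF m(1)]
      by (intro measure_Un_le) auto
    then show ?thesis using K(3) L(3) by simp
  qed
  have "measure (ms n) ?E < e / 3" for n using mE E by (intro d0(2)) (auto simp: d_def)
  then have 1: "\<bar>measure (ms n) A - (LINT t|ms n. g t)\<bar> < e / 3" for n
    using close[OF ms, of n] by (meson le_less_trans)
  have 2: "\<bar>measure m A - (LINT t|m. g t)\<bar> < e / 3"
    using close[OF m(1)] mE by (simp add: d_def)
  have "(\<lambda>n. LINT t|ms n. g t) \<longlonglongrightarrow> (LINT t|m. g t)" using v g(1) by (simp add: vaguely_converges_def)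
  then obtain N where N: "\<And>n. n \<ge> N \<Longrightarrow> norm ((LINT t|ms n. g t) - (LINT t|m. g t)) < e / 3"
    using LIMSEQ_D[of _ _ "e/3"] e by (metis zero_less_divide_iff zero_less_numeral)
  have "norm (measure (ms n) A - measure m A) < e" if "n \<ge> N" for n
    using N[OF that] 1[of n] 2 unfolding real_norm_def by linarith
  then show "\<exists>N. \<forall>n\<ge>N. norm (measure (ms n) A - measure m A) < e" by blast
qed

section \<open>Limits of integrals under setwise convergence of measures\<close>

definition converges_setwise :: "(nat \<Rightarrow> 'a::topological_space measure) \<Rightarrow> 'a measure \<Rightarrow> bool"
  where "converges_setwise ms m \<longleftrightarrow>
    (\<forall>A\<in>sets borel. (\<lambda>n. measure (ms n) A) \<longlonglongrightarrow> measure m A)"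

lemma borel_measurable_fbm:
  assumes "m \<in> finite_borel_measures"
  shows "borel_measurable m = borel_measurable borel"
  by (rule measurable_cong_sets[OF finite_borel_measuresD(2)[OF assms] refl])

lemma integrable_bounded_fbm:
  fixes h :: "'a::topological_space \<Rightarrow> real"
  assumes "m \<in> finite_borel_measures" "h \<in> borel_measurable borel" "\<And>t. \<bar>h t\<bar> \<le> B"
  shows "integrable m h"
proof -
  interpret finite_measure m by (rule finite_borel_measuresD[OF assms(1)])
  show ?thesis
    by (rule integrable_const_bound[of _ B]) (use assms in \<open>auto simp: borel_measurable_fbm\<close>)
qed

text \<open>A bounded Borel function is a uniform limit of the finitely valued functions \<open>\<lfloor>h t * k\<rfloor> / k\<close>, whose
  integrals are finite linear combinations of measures of Borel sets.\<close>

theorem setwise_imp_integral_bounded: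
  fixes h :: "'a::topological_space \<Rightarrow> real"
  assumes m: "m \<in> finite_borel_measures" and ms: "\<And>n. ms n \<in> finite_borel_measures"
    and sw: "converges_setwise ms m"
    and h: "h \<in> borel_measurable borel" and B: "\<And>t. \<bar>h t\<bar> \<le> B"
  shows "(\<lambda>n. LINT t|ms n. h t) \<longlonglongrightarrow> (LINT t|m. h t)"
proof (rule LIMSEQ_I)
  fix e :: real assume e: "e > 0"
  define M where "M = measure m UNIV + 1"
  have M: "M > 0" by (simp add: M_def add_nonneg_pos)
  obtain k :: nat where k: "k > 0" "M / real k < e / 3"
  proof -
    obtain k :: nat where "3 * M / e < real k" using reals_Archimedean2 by blast
    moreover have "3 * M / e > 0" using M e by simp
    ultimately have k: "real k > 0" "3 * M < real k * e" using e by (linarith, simp add: field_simps)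
    then have "M / real k < e / 3" by (simp add: pos_divide_less_eq[OF k(1)] algebra_simps)
    with k(1) show ?thesis by (intro that) simp_all
  qed
  define I where "I = {\<lfloor>- B * k\<rfloor>..\<lfloor>B * k\<rfloor>}"
  define E where "E i = {t. \<lfloor>h t * k\<rfloor> = i}" for i
  define s where "s t = (\<Sum>i\<in>I. (real_of_int i / k) * indicator (E i) t)" for t
  have E: "E i \<in> sets borel" for i
  proof -
    have "(\<lambda>t. h t * real k) \<in> borel_measurable borel"
      by (intro borel_measurable_times h borel_measurable_const)
    moreover have "E i = (\<lambda>t. h t * real k) -` {real_of_int i..<real_of_int i + 1} \<inter> space borel"
      by (auto simp: E_def floor_eq_iff)
    ultimately show ?thesis using measurable_sets[of "\<lambda>t. h t * real k" borel borel] by simp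
  qed
  have s_eq: "s t = \<lfloor>h t * k\<rfloor> / k" for t
  proof -
    have "- B \<le> h t" "h t \<le> B" using B[of t] by linarith+
    then have "- B * k \<le> h t * k" "h t * k \<le> B * k" by (intro mult_right_mono; simp)+
    then have "\<lfloor>h t * k\<rfloor> \<in> I" unfolding I_def atLeastAtMost_iff by (intro conjI floor_mono)
    have "s t = (\<Sum>i\<in>I. if i = \<lfloor>h t * k\<rfloor> then real_of_int i / k else 0)"
      unfolding s_def by (rule sum.cong) (auto simp: E_def indicator_def)
    then show ?thesis using \<open>\<lfloor>h t * k\<rfloor> \<in> I\<close> by (simp add: I_def)
  qed
  have near: "\<bar>h t - s t\<bar> \<le> 1 / k" for t
  proof -
    have "\<bar>h t * k - \<lfloor>h t * k\<rfloor>\<bar> \<le> 1" by linarith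
    moreover have "h t - s t = (h t * k - \<lfloor>h t * k\<rfloor>) / k" using k by (simp add: s_eq field_simps)
    ultimately show ?thesis using k by (simp add: divide_right_mono)
  qed
  have int_s: "integrable \<mu> s" "(LINT t|\<mu>. s t) = (\<Sum>i\<in>I. (real_of_int i / k) * measure \<mu> (E i))"
    if \<mu>: "\<mu> \<in> finite_borel_measures" for \<mu>
  proof -
    interpret finite_measure \<mu> by (rule finite_borel_measuresD[OF \<mu>])
    have i: "integrable \<mu> (\<lambda>t. (real_of_int i / k) * indicator (E i) t)" for i
      using E finite_borel_measuresD(2)[OF \<mu>] by (intro integrable_mult_right) (simp add: emeasure_eq_measure)
    show "integrable \<mu> s" unfolding s_def by (intro Bochner_Integration.integrable_sum i)
    have "(LINT t|\<mu>. s t) = (\<Sum>i\<in>I. LINT t|\<mu>. (real_of_int i / k) * indicator (E i) t)"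
      unfolding s_def by (rule Bochner_Integration.integral_sum) (rule i)
    then show "(LINT t|\<mu>. s t) = (\<Sum>i\<in>I. (real_of_int i / k) * measure \<mu> (E i))"
      using E finite_borel_measuresD(2,3)[OF \<mu>] by simp
  qed
  have close: "\<bar>(LINT t|\<mu>. h t) - (LINT t|\<mu>. s t)\<bar> \<le> measure \<mu> UNIV / k"
    if \<mu>: "\<mu> \<in> finite_borel_measures" for \<mu>
  proof -
    interpret finite_measure \<mu> by (rule finite_borel_measuresD[OF \<mu>])
    have ih: "integrable \<mu> h" by (rule integrable_bounded_fbm[OF \<mu> h B])
    have "(LINT t|\<mu>. h t) - (LINT t|\<mu>. s t) = (LINT t|\<mu>. h t - s t)"
      using ih int_s(1)[OF \<mu>] by simp
    also have "\<bar>\<dots>\<bar> \<le> (LINT t|\<mu>. \<bar>h t - s t\<bar>)" by (rule integral_abs_bound)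
    also have "\<dots> \<le> (LINT t|\<mu>. 1 / k)"
      using ih int_s(1)[OF \<mu>] near by (intro integral_mono) auto
    also have "\<dots> = measure \<mu> UNIV / k" by (simp add: finite_borel_measuresD(3)[OF \<mu>])
    finally show ?thesis .
  qed
  have "(\<lambda>n. LINT t|ms n. s t) \<longlonglongrightarrow> (LINT t|m. s t)"
    unfolding int_s(2)[OF ms] int_s(2)[OF m]
    using sw E by (intro tendsto_sum tendsto_mult tendsto_const) (auto simp: converges_setwise_def)
  then have 1: "eventually (\<lambda>n. \<bar>(LINT t|ms n. s t) - (LINT t|m. s t)\<bar> < e / 3) sequentially"
    using e by (auto dest!: tendstoD[where e = "e/3"] simp: dist_real_def)
  have "(\<lambda>n. measure (ms n) UNIV) \<longlonglongrightarrow> measure m UNIV" using sw by (simp add: converges_setwise_def)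
  then have 2: "eventually (\<lambda>n. measure (ms n) UNIV < M) sequentially"
    by (rule order_tendstoD) (simp add: M_def)
  have "eventually (\<lambda>n. norm ((LINT t|ms n. h t) - (LINT t|m. h t)) < e) sequentially"
    using 1 2
  proof eventually_elim
    case (elim n)
    have "measure (ms n) UNIV / k \<le> M / k" using elim(2) by (simp add: divide_right_mono)
    then have a: "\<bar>(LINT t|ms n. h t) - (LINT t|ms n. s t)\<bar> < e / 3" using close[OF ms, of n] k(2) by linarith
    have "measure m UNIV / k \<le> M / k" by (simp add: M_def divide_right_mono)
    then have b: "\<bar>(LINT t|m. h t) - (LINT t|m. s t)\<bar> < e / 3" using close[OF m] k(2) by linarith
    show ?case using a b elim(1) unfolding real_norm_def by linarith
  qed
  then show "\<exists>N. \<forall>n\<ge>N. norm ((LINT t|ms n. h t) - (LINT t|m. h t)) < e"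
    by (simp add: eventually_sequentially)
qed

lemma abs_set_integral_le:
  fixes h :: "'a::topological_space \<Rightarrow> real"
  assumes m: "m \<in> finite_borel_measures" and h: "h \<in> borel_measurable borel" and A: "A \<in> sets borel" "A \<subseteq> E"
    and le: "(\<integral>\<^sup>+t\<in>E. ennreal \<bar>h t\<bar> \<partial>m) \<le> ennreal e" and e: "e \<ge> 0"
  shows "\<bar>LINT t:A|m. h t\<bar> \<le> e"
proof (cases "integrable m (\<lambda>t. indicator A t *\<^sub>R h t)")
  case True
  then have "ennreal (norm (LINT t:A|m. h t)) \<le> (\<integral>\<^sup>+t. ennreal (norm (indicator A t *\<^sub>R h t)) \<partial>m)"
    unfolding set_lebesgue_integral_def by (rule integral_norm_bound_ennreal)
  also have "\<dots> \<le> (\<integral>\<^sup>+t\<in>E. ennreal \<bar>h t\<bar> \<partial>m)"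
    using A(2) by (intro nn_integral_mono) (auto simp: indicator_def)
  also have "\<dots> \<le> ennreal e" by (rule le)
  finally show ?thesis using e by simp
next
  case False
  then show ?thesis using e by (simp add: set_lebesgue_integral_def not_integrable_integral_eq)
qed

text \<open>Truncations of \<open>h\<close> are bounded, so the bound passes to the limit measure for each of them; monotone
  convergence removes the truncation. The same \<open>d\<close> works for the limit, which keeps the bound uniform
  when it is applied to a whole family of functions.\<close>

lemma setwise_limit_tail_bound:
  fixes h :: "'a::topological_space \<Rightarrow> real"
  assumes m: "m \<in> finite_borel_measures" and ms: "\<And>n. ms n \<in> finite_borel_measures"
    and sw: "converges_setwise ms m" and h: "h \<in> borel_measurable borel"
    and le: "\<And>n A. A \<in> sets borel \<Longrightarrow> measure (ms n) A < d \<Longrightarrow> (\<integral>\<^sup>+t\<in>A. ennreal \<bar>h t\<bar> \<partial>ms n) \<le> ennreal e"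
    and e: "e \<ge> 0" and A: "A \<in> sets borel" "measure m A < d"
  shows "(\<integral>\<^sup>+t\<in>A. ennreal \<bar>h t\<bar> \<partial>m) \<le> ennreal e"
proof -
  define g where "g k t = min \<bar>h t\<bar> (real k) * indicator A t" for k :: nat and t
  have g: "g k \<in> borel_measurable borel" "\<bar>g k t\<bar> \<le> real k" "0 \<le> g k t" for k t
  proof -
    show "g k \<in> borel_measurable borel" unfolding g_def using h A(1) by measurable
  qed (auto simp: g_def indicator_def)
  have int_g: "integrable \<mu> (g k)" if "\<mu> \<in> finite_borel_measures" for \<mu> k
    by (rule integrable_bounded_fbm[OF that g(1,2)])
  have gm: "(LINT t|m. g k t) \<le> e" for k
  proof (rule LIMSEQ_le_const2[OF setwise_imp_integral_bounded[OF m ms sw g(1,2)]])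
    have "(\<lambda>n. measure (ms n) A) \<longlonglongrightarrow> measure m A" using sw A by (simp add: converges_setwise_def)
    then have "eventually (\<lambda>n. measure (ms n) A < d) sequentially"
      by (rule order_tendstoD) (rule A(2))
    then obtain N where N: "\<And>n. n \<ge> N \<Longrightarrow> measure (ms n) A < d" by (auto simp: eventually_sequentially)
    have "(LINT t|ms n. g k t) \<le> e" if "n \<ge> N" for n
    proof -
      have "ennreal (LINT t|ms n. g k t) = (\<integral>\<^sup>+t. ennreal (g k t) \<partial>ms n)"
        by (rule nn_integral_eq_integral[OF int_g[OF ms], symmetric]) (simp add: g(3))
      also have "\<dots> \<le> (\<integral>\<^sup>+t\<in>A. ennreal \<bar>h t\<bar> \<partial>ms n)"
        by (intro nn_integral_mono) (auto simp: g_def indicator_def intro: ennreal_leI)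
      also have "\<dots> \<le> ennreal e" by (rule le[OF A(1) N[OF that]])
      finally show ?thesis using e by simp
    qed
    then show "\<exists>N. \<forall>n\<ge>N. (LINT t|ms n. g k t) \<le> e" by blast
  qed
  have "(\<integral>\<^sup>+t\<in>A. ennreal \<bar>h t\<bar> \<partial>m) = (\<integral>\<^sup>+t. (SUP k. ennreal (g k t)) \<partial>m)"
  proof (rule nn_integral_cong)
    fix t
    have "(SUP k. ennreal (g k t)) = ennreal \<bar>h t\<bar> * indicator A t"
    proof (rule antisym)
      show "(SUP k. ennreal (g k t)) \<le> ennreal \<bar>h t\<bar> * indicator A t"
        by (rule SUP_least) (auto simp: g_def indicator_def intro: ennreal_leI)
      obtain k :: nat where "\<bar>h t\<bar> \<le> real k" using real_arch_simple by blast
      then have "ennreal \<bar>h t\<bar> * indicator A t \<le> ennreal (g k t)" by (auto simp: g_def indicator_def)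
      then show "ennreal \<bar>h t\<bar> * indicator A t \<le> (SUP k. ennreal (g k t))" by (rule SUP_upper2[OF UNIV_I])
    qed
    then show "ennreal \<bar>h t\<bar> * indicator A t = (SUP k. ennreal (g k t))" by simp
  qed
  also have "\<dots> = (SUP k. \<integral>\<^sup>+t. ennreal (g k t) \<partial>m)"
  proof (rule nn_integral_monotone_convergence_SUP)
    show "incseq (\<lambda>k t. ennreal (g k t))"
      by (auto simp: incseq_def le_fun_def g_def indicator_def intro!: ennreal_leI)
    show "(\<lambda>t. ennreal (g k t)) \<in> borel_measurable m" for k
      using g(1)[of k] by (simp add: borel_measurable_fbm[OF m] measurable_compose[OF _ measurable_ennreal])
  qed
  also have "\<dots> \<le> ennreal e"
  proof (rule SUP_least)
    fix k
    have "(\<integral>\<^sup>+t. ennreal (g k t) \<partial>m) = ennreal (LINT t|m. g k t)"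
      by (rule nn_integral_eq_integral[OF int_g[OF m]]) (simp add: g(3))
    also have "\<dots> \<le> ennreal e" by (rule ennreal_leI[OF gm])
    finally show "(\<integral>\<^sup>+t. ennreal (g k t) \<partial>m) \<le> ennreal e" .
  qed
  finally show ?thesis .
qed

lemma level_set_small:
  fixes h :: "'a::topological_space \<Rightarrow> real"
  assumes m: "m \<in> finite_borel_measures" and h: "h \<in> borel_measurable borel" and d: "d > 0"
  obtains k :: nat where "measure m {t. \<bar>h t\<bar> > real k} < d"
proof -
  interpret finite_measure m by (rule finite_borel_measuresD[OF m])
  let ?E = "\<lambda>k :: nat. {t. \<bar>h t\<bar> > real k}"
  have "?E k \<in> sets borel" for k using h by measurable
  then have "(\<lambda>k. measure m (?E k)) \<longlonglongrightarrow> measure m (\<Inter>k. ?E k)"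
    by (intro finite_Lim_measure_decseq) (auto simp: decseq_def finite_borel_measuresD(2)[OF m])
  moreover have "(\<Inter>k. ?E k) = {}"
  proof -
    have "\<exists>k. \<not> \<bar>h t\<bar> > real k" for t using real_arch_simple[of "\<bar>h t\<bar>"] by (auto simp: not_less)
    then show ?thesis by blast
  qed
  ultimately have "(\<lambda>k. measure m (?E k)) \<longlonglongrightarrow> 0" by simp
  then have "eventually (\<lambda>k. measure m (?E k) < d) sequentially" by (rule order_tendstoD) (rule d)
  then obtain k where "measure m (?E k) < d" by (auto simp: eventually_sequentially)
  then show ?thesis by (rule that)
qed

lemma integrable_of_tail_bounds:
  fixes h :: "'a::topological_space \<Rightarrow> real"
  assumes m: "m \<in> finite_borel_measures" and h: "h \<in> borel_measurable borel" and d: "d > 0"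
    and le: "\<And>A. A \<in> sets borel \<Longrightarrow> measure m A < d \<Longrightarrow> (\<integral>\<^sup>+t\<in>A. ennreal \<bar>h t\<bar> \<partial>m) \<le> ennreal e"
  shows "integrable m h"
proof (rule integrableI_bounded)
  interpret finite_measure m by (rule finite_borel_measuresD[OF m])
  show "h \<in> borel_measurable m" using h by (simp add: borel_measurable_fbm[OF m])
  obtain k :: nat where k: "measure m {t. \<bar>h t\<bar> > real k} < d" by (rule level_set_small[OF m h d])
  let ?E = "{t. \<bar>h t\<bar> > real k}"
  have E: "?E \<in> sets borel" using h by measurable
  have "(\<integral>\<^sup>+t. ennreal (norm (h t)) \<partial>m) \<le> (\<integral>\<^sup>+t. ennreal \<bar>h t\<bar> * indicator ?E t + ennreal (real k) \<partial>m)"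
    by (rule nn_integral_mono) (auto simp: indicator_def intro: ennreal_leI)
  also have "\<dots> = (\<integral>\<^sup>+t\<in>?E. ennreal \<bar>h t\<bar> \<partial>m) + ennreal (real k) * emeasure m (space m)"
    using h E by (subst nn_integral_add) (auto simp: borel_measurable_fbm[OF m])
  also have "\<dots> < \<infinity>"
    using le[OF E k] by (auto simp: emeasure_eq_measure ennreal_mult_less_top top_unique intro: le_less_trans)
  finally show "(\<integral>\<^sup>+t. ennreal (norm (h t)) \<partial>m) < \<infinity>" .
qed

lemma set_integral_split:
  fixes h :: "'a::topological_space \<Rightarrow> real"
  assumes m: "m \<in> finite_borel_measures" and h: "integrable m h" and A: "A \<in> sets borel" and E: "E \<in> sets borel"
  shows "(LINT t:A|m. h t) = (LINT t:A - E|m. h t) + (LINT t:A \<inter> E|m. h t)"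
proof -
  have "(LINT t:(A - E) \<union> (A \<inter> E)|m. h t) = (LINT t:A - E|m. h t) + (LINT t:A \<inter> E|m. h t)"
    using assms finite_borel_measuresD(2)[OF m]
    by (intro set_integral_Un)
      (auto simp: set_integrable_def simp del: real_scaleR_def intro!: integrable_mult_indicator)
  moreover have "(A - E) \<union> (A \<inter> E) = A" by blast
  ultimately show ?thesis by simp
qed

text \<open>The set where \<open>\<bar>h\<bar>\<close> exceeds a large \<open>k\<close> is small for \<open>m\<close>, hence for all \<open>ms n\<close>, and contributes little to
  any of the integrals. On its complement \<open>h\<close> is bounded.\<close>

theorem setwise_imp_set_integral:
  fixes h :: "'a::topological_space \<Rightarrow> real"
  assumes m: "m \<in> finite_borel_measures" and ms: "\<And>n. ms n \<in> finite_borel_measures"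
    and sw: "converges_setwise ms m" and u: "unif_abs_continuous ms m"
    and h: "h \<in> borel_measurable borel" "\<And>n. integrable (ms n) h"
    and ui: "\<And>e. e > 0 \<Longrightarrow> \<exists>d>0. \<forall>n. \<forall>A\<in>sets borel. measure (ms n) A < d \<longrightarrow>
      (\<integral>\<^sup>+t\<in>A. ennreal \<bar>h t\<bar> \<partial>ms n) \<le> ennreal e"
    and A: "A \<in> sets borel"
  shows "(\<lambda>n. LINT t:A|ms n. h t) \<longlonglongrightarrow> (LINT t:A|m. h t)"
proof (rule tendstoI)
  fix e :: real assume e: "e > 0"
  obtain d where d: "d > 0" "\<And>n A. A \<in> sets borel \<Longrightarrow> measure (ms n) A < d \<Longrightarrow>
      (\<integral>\<^sup>+t\<in>A. ennreal \<bar>h t\<bar> \<partial>ms n) \<le> ennreal (e / 3)"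
    using ui[of "e / 3"] e by auto
  have dm: "(\<integral>\<^sup>+t\<in>A. ennreal \<bar>h t\<bar> \<partial>m) \<le> ennreal (e / 3)" if "A \<in> sets borel" "measure m A < d" for A
    by (rule setwise_limit_tail_bound[OF m ms sw h(1) d(2) _ that]) (use e in auto)
  have hm: "integrable m h" by (rule integrable_of_tail_bounds[OF m h(1) d(1) dm])
  obtain d' where d': "d' > 0" "\<And>E n. E \<in> sets borel \<Longrightarrow> measure m E < d' \<Longrightarrow> measure (ms n) E < d"
    by (rule unif_abs_continuousD[OF u m ms d(1)]) blast
  obtain k :: nat where k: "measure m {t. \<bar>h t\<bar> > real k} < min d d'"
    by (rule level_set_small[OF m h(1), of "min d d'"]) (use d d' in auto)
  define E where "E = {t. \<bar>h t\<bar> > real k}"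
  have E: "E \<in> sets borel" unfolding E_def using h(1) by measurable
  have AE: "A \<inter> E \<in> sets borel" "A - E \<in> sets borel" using A E by auto
  have tail: "\<bar>LINT t:A \<inter> E|\<mu>. h t\<bar> \<le> e / 3"
    if "\<mu> \<in> finite_borel_measures" "(\<integral>\<^sup>+t\<in>E. ennreal \<bar>h t\<bar> \<partial>\<mu>) \<le> ennreal (e / 3)" for \<mu>
    by (rule abs_set_integral_le[OF that(1) h(1) AE(1) _ that(2)]) (use e in auto)
  have "(\<lambda>n. LINT t:A - E|ms n. h t) \<longlonglongrightarrow> (LINT t:A - E|m. h t)"
    unfolding set_lebesgue_integral_def
  proof (rule setwise_imp_integral_bounded[OF m ms sw])
    show "(\<lambda>t. indicator (A - E) t *\<^sub>R h t) \<in> borel_measurable borel" using h(1) AE by measurable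
    show "\<bar>indicator (A - E) t *\<^sub>R h t\<bar> \<le> real k" for t by (auto simp: E_def indicator_def)
  qed
  then have "eventually (\<lambda>n. dist (LINT t:A - E|ms n. h t) (LINT t:A - E|m. h t) < e / 3) sequentially"
    using e by (intro tendstoD) auto
  then show "eventually (\<lambda>n. dist (LINT t:A|ms n. h t) (LINT t:A|m. h t) < e) sequentially"
  proof eventually_elim
    case (elim n)
    have "measure (ms n) E < d" using d'(2)[OF E] k by (simp add: E_def)
    then have "\<bar>LINT t:A \<inter> E|ms n. h t\<bar> \<le> e / 3" by (intro tail ms d(2)[OF E])
    moreover have "\<bar>LINT t:A \<inter> E|m. h t\<bar> \<le> e / 3" using k by (intro tail m dm[OF E]) (simp add: E_def)
    ultimately show ?case
      using elim set_integral_split[OF ms h(2) A E, of n] set_integral_split[OF m hm A E]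
      unfolding dist_real_def by linarith
  qed
qed

lemma measure_large_deviation_tendsto_0:
  fixes h :: "'a::topological_space \<Rightarrow> real" and hs :: "nat \<Rightarrow> 'a \<Rightarrow> real"
  assumes m: "m \<in> finite_borel_measures" and h: "h \<in> borel_measurable borel" "\<And>n. hs n \<in> borel_measurable borel"
    and ae: "AE t in m. (\<lambda>n. hs n t) \<longlonglongrightarrow> h t" and e: "e > 0"
  shows "(\<lambda>n. measure m {t. \<bar>hs n t - h t\<bar> > e}) \<longlonglongrightarrow> 0"
proof -
  interpret finite_measure m by (rule finite_borel_measuresD[OF m])
  define E where "E n = {t. \<bar>hs n t - h t\<bar> > e}" for n
  have E: "E n \<in> sets borel" for n unfolding E_def using h by measurable
  have "(\<lambda>n. LINT t|m. indicator (E n) t :: real) \<longlonglongrightarrow> (LINT t|m. 0)"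
  proof (rule integral_dominated_convergence[where w = "\<lambda>_. 1"])
    show "AE t in m. (\<lambda>n. indicator (E n) t :: real) \<longlonglongrightarrow> 0"
      using ae
    proof eventually_elim
      case (elim t)
      then have "eventually (\<lambda>n. dist (hs n t) (h t) < e) sequentially" using e by (rule tendstoD)
      then have "eventually (\<lambda>n. indicator (E n) t = (0::real)) sequentially"
        by eventually_elim (simp add: E_def dist_real_def)
      then show ?case by (rule tendsto_eventually)
    qed
    show "(indicator (E n) :: 'a \<Rightarrow> real) \<in> borel_measurable m" for n
      using E by (simp add: finite_borel_measuresD(2)[OF m] borel_measurable_indicator)
  qed (auto simp: indicator_def)
  then show ?thesis using E finite_borel_measuresD(2,3)[OF m] by (simp add: E_def[abs_def])
qed

text \<open>Off the set where \<open>hs n\<close> and \<open>h\<close> differ by more than \<open>c\<close> the two integrals under \<open>ms n\<close> are close since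
  the total masses stay bounded. Almost everywhere convergence makes the exceptional set small for \<open>m\<close>,
  hence for \<open>ms n\<close>, where uniform integrability takes over. This compares the integrals of \<open>hs n\<close> and \<open>h\<close>
  under \<open>ms n\<close>; \<open>setwise_imp_set_integral\<close> then replaces \<open>ms n\<close> by \<open>m\<close>.\<close>

theorem vitali_varying_measures:
  fixes h :: "'a::topological_space \<Rightarrow> real" and hs :: "nat \<Rightarrow> 'a \<Rightarrow> real"
  assumes m: "m \<in> finite_borel_measures" and ms: "\<And>n. ms n \<in> finite_borel_measures"
    and sw: "converges_setwise ms m" and u: "unif_abs_continuous ms m"
    and h: "h \<in> borel_measurable borel" "\<And>n. integrable (ms n) h"
    and hs: "\<And>n. hs n \<in> borel_measurable borel" "\<And>n. integrable (ms n) (hs n)"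
    and ui: "\<And>e. e > 0 \<Longrightarrow> \<exists>d>0. \<forall>n. \<forall>A\<in>sets borel. measure (ms n) A < d \<longrightarrow>
      (\<integral>\<^sup>+t\<in>A. ennreal \<bar>h t\<bar> \<partial>ms n) \<le> ennreal e"
    and uis: "\<And>e. e > 0 \<Longrightarrow> \<exists>d>0. \<forall>n. \<forall>A\<in>sets borel. measure (ms n) A < d \<longrightarrow>
      (\<integral>\<^sup>+t\<in>A. ennreal \<bar>hs n t\<bar> \<partial>ms n) \<le> ennreal e"
    and ae: "AE t in m. (\<lambda>n. hs n t) \<longlonglongrightarrow> h t"
    and A: "A \<in> sets borel"
  shows "(\<lambda>n. LINT t:A|ms n. hs n t) \<longlonglongrightarrow> (LINT t:A|m. h t)"
proof -
  have "(\<lambda>n. (LINT t:A|ms n. hs n t) - (LINT t:A|ms n. h t)) \<longlonglongrightarrow> 0"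
  proof (rule tendstoI)
    fix e :: real assume e: "e > 0"
    define M where "M = measure m UNIV + 1"
    have M: "M > 0" by (simp add: M_def add_nonneg_pos)
    \<comment> \<open>All but finitely many \<open>ms n\<close> have total mass below \<open>M\<close>, so a deviation of \<open>c\<close> costs at most \<open>e / 4\<close>.\<close>
    define c where "c = e / (4 * M)"
    have c: "c > 0" "c * M = e / 4" using e M by (simp_all add: c_def)
    obtain d1 where d1: "d1 > 0" "\<And>n A. A \<in> sets borel \<Longrightarrow> measure (ms n) A < d1 \<Longrightarrow>
        (\<integral>\<^sup>+t\<in>A. ennreal \<bar>h t\<bar> \<partial>ms n) \<le> ennreal (e / 4)"
      using ui[of "e / 4"] e by auto
    obtain d2 where d2: "d2 > 0" "\<And>n A. A \<in> sets borel \<Longrightarrow> measure (ms n) A < d2 \<Longrightarrow>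
        (\<integral>\<^sup>+t\<in>A. ennreal \<bar>hs n t\<bar> \<partial>ms n) \<le> ennreal (e / 4)"
      using uis[of "e / 4"] e by auto
    obtain d where d: "d > 0" "\<And>E n. E \<in> sets borel \<Longrightarrow> measure m E < d \<Longrightarrow> measure (ms n) E < min d1 d2"
      by (rule unif_abs_continuousD[OF u m ms, of "min d1 d2"]) (use d1 d2 in auto)
    define E where "E n = {t. \<bar>hs n t - h t\<bar> > c}" for n
    have E: "E n \<in> sets borel" for n unfolding E_def using h(1) hs(1) by measurable
    have "(\<lambda>n. measure m (E n)) \<longlonglongrightarrow> 0"
      unfolding E_def by (rule measure_large_deviation_tendsto_0[OF m h(1) hs(1) ae c(1)])
    then have 1: "eventually (\<lambda>n. measure m (E n) < d) sequentially" by (rule order_tendstoD) (rule d)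
    have "(\<lambda>n. measure (ms n) UNIV) \<longlonglongrightarrow> measure m UNIV" using sw by (simp add: converges_setwise_def)
    then have 2: "eventually (\<lambda>n. measure (ms n) UNIV < M) sequentially"
      by (rule order_tendstoD) (simp add: M_def)
    from 1 2
    show "eventually (\<lambda>n. dist ((LINT t:A|ms n. hs n t) - (LINT t:A|ms n. h t)) 0 < e) sequentially"
    proof eventually_elim
      case (elim n)
      interpret finite_measure "ms n" by (rule finite_borel_measuresD[OF ms])
      have En: "measure (ms n) (E n) < d1" "measure (ms n) (E n) < d2" using d(2)[OF E elim(1)] by auto
      have AE: "A \<inter> E n \<in> sets borel" "A - E n \<in> sets borel" using A E by auto
      have t1: "\<bar>LINT t:A \<inter> E n|ms n. h t\<bar> \<le> e / 4"
        by (rule abs_set_integral_le[OF ms h(1) AE(1) _ d1(2)[OF E En(1)]]) (use e in auto)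
      have t2: "\<bar>LINT t:A \<inter> E n|ms n. hs n t\<bar> \<le> e / 4"
        by (rule abs_set_integral_le[OF ms hs(1) AE(1) _ d2(2)[OF E En(2)]]) (use e in auto)
      have si: "integrable (ms n) (\<lambda>t. indicator (A - E n) t *\<^sub>R h t)" "integrable (ms n) (\<lambda>t. indicator (A - E n) t *\<^sub>R hs n t)"
        using h(2) hs(2) AE finite_borel_measuresD(2)[OF ms]
        by (auto simp del: real_scaleR_def intro!: integrable_mult_indicator)
      have "(LINT t:A - E n|ms n. hs n t) - (LINT t:A - E n|ms n. h t)
          = (LINT t|ms n. indicator (A - E n) t *\<^sub>R hs n t - indicator (A - E n) t *\<^sub>R h t)"
        unfolding set_lebesgue_integral_def using si by simp
      also have "\<bar>\<dots>\<bar> \<le> (LINT t|ms n. \<bar>indicator (A - E n) t *\<^sub>R hs n t - indicator (A - E n) t *\<^sub>R h t\<bar>)"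
        by (rule integral_abs_bound)
      also have "\<dots> \<le> (LINT t|ms n. c)"
        using si c(1) by (intro integral_mono) (auto simp: E_def indicator_def)
      also have "\<dots> = c * measure (ms n) UNIV" by (simp add: finite_borel_measuresD(3)[OF ms])
      also have "\<dots> \<le> c * M" using elim(2) c(1) by (intro mult_left_mono) auto
      finally have t3: "\<bar>(LINT t:A - E n|ms n. hs n t) - (LINT t:A - E n|ms n. h t)\<bar> \<le> e / 4" using c(2) by simp
      show ?case
        unfolding set_integral_split[OF ms[of n] h(2) A E[of n]]
          set_integral_split[OF ms[of n] hs(2) A E[of n]] dist_real_def
        using t1 t2 t3 e unfolding abs_le_iff abs_less_iff by linarith
    qed
  qed
  from tendsto_add[OF this setwise_imp_set_integral[OF m ms sw u h ui A]] show ?thesis by simp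
qed

section \<open>The Pettis integral of the limit multifunction\<close>

lemma support_fun_scale_norm:
  assumes C: "C \<in> cwk"
  shows "support_fun f C = norm f * support_fun ((1 / norm f) *\<^sub>R f) C"
proof (cases "f = 0")
  case True
  then show ?thesis using sublinear_0[OF sublinear_support_fun[OF cwkD(1,2)[OF C]]] by simp
next
  case False
  then show ?thesis
    using sublinear_scale[OF sublinear_support_fun[OF cwkD(1,2)[OF C]], of "norm f" "(1 / norm f) *\<^sub>R f"]
    by simp
qed

text \<open>Positive homogeneity of the support function extends the bound from the unit ball to all functionals,
  with a factor \<open>norm f\<close> and the same \<open>d\<close>.\<close>

lemma unif_abs_cont_scalar_integralsD:
  fixes \<Gamma>s :: "nat \<Rightarrow> 'a::topological_space \<Rightarrow> 'b::real_normed_vector set"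
  assumes j: "unif_abs_cont_scalar_integrals ms \<Gamma>s" and ms: "\<And>n. ms n \<in> finite_borel_measures"
    and \<Gamma>s: "\<And>n t. \<Gamma>s n t \<in> cwk" and meas: "\<And>n. scalarly_measurable (\<Gamma>s n)" and e: "e > 0"
  obtains d where "d > 0" "\<And>n A f. A \<in> sets borel \<Longrightarrow> measure (ms n) A < d \<Longrightarrow>
    (\<integral>\<^sup>+t\<in>A. ennreal \<bar>support_fun f (\<Gamma>s n t)\<bar> \<partial>ms n) \<le> ennreal (e * norm f)"
proof -
  obtain d where d: "d > 0"
    "\<forall>n. \<forall>A\<in>sets borel. emeasure (ms n) A < ennreal d \<longrightarrow>
      (SUP f\<in>{f. norm f \<le> 1}. \<integral>\<^sup>+t\<in>A. ennreal \<bar>support_fun f (\<Gamma>s n t)\<bar> \<partial>ms n) < ennreal e"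
    using j[unfolded unif_abs_cont_scalar_integrals_def, THEN conjunct2, rule_format, OF e] by blast
  show ?thesis
  proof (rule that[OF d(1)])
    fix n A and f :: "'b \<Rightarrow>\<^sub>L real" assume A: "A \<in> sets borel" "measure (ms n) A < d"
    interpret finite_measure "ms n" by (rule finite_borel_measuresD[OF ms])
    let ?u = "(1 / norm f) *\<^sub>R f"
    have u: "norm ?u \<le> 1" by simp
    have "(\<integral>\<^sup>+t\<in>A. ennreal \<bar>support_fun f (\<Gamma>s n t)\<bar> \<partial>ms n)
        = (\<integral>\<^sup>+t. ennreal (norm f) * (ennreal \<bar>support_fun ?u (\<Gamma>s n t)\<bar> * indicator A t) \<partial>ms n)"
    proof (rule nn_integral_cong)
      fix t
      have "\<bar>support_fun f (\<Gamma>s n t)\<bar> = norm f * \<bar>support_fun ?u (\<Gamma>s n t)\<bar>"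
        by (subst support_fun_scale_norm[OF \<Gamma>s]) (simp add: abs_mult)
      then show "ennreal \<bar>support_fun f (\<Gamma>s n t)\<bar> * indicator A t
          = ennreal (norm f) * (ennreal \<bar>support_fun ?u (\<Gamma>s n t)\<bar> * indicator A t)"
        by (simp add: ennreal_mult mult.assoc)
    qed
    also have "\<dots> = ennreal (norm f) * (\<integral>\<^sup>+t\<in>A. ennreal \<bar>support_fun ?u (\<Gamma>s n t)\<bar> \<partial>ms n)"
    proof (rule nn_integral_cmult)
      have "(\<lambda>t. support_fun ?u (\<Gamma>s n t)) \<in> borel_measurable (ms n)"
        using meas[of n] by (simp add: scalarly_measurable_def borel_measurable_fbm[OF ms])
      moreover have "A \<in> sets (ms n)" using A(1) finite_borel_measuresD(2)[OF ms] by simp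
      ultimately show "(\<lambda>t. ennreal \<bar>support_fun ?u (\<Gamma>s n t)\<bar> * indicator A t) \<in> borel_measurable (ms n)"
        by measurable
    qed
    also have "\<dots> \<le> ennreal (norm f) * ennreal e"
    proof (rule mult_left_mono)
      have "(\<integral>\<^sup>+t\<in>A. ennreal \<bar>support_fun ?u (\<Gamma>s n t)\<bar> \<partial>ms n)
          \<le> (SUP f\<in>{f. norm f \<le> 1}. \<integral>\<^sup>+t\<in>A. ennreal \<bar>support_fun f (\<Gamma>s n t)\<bar> \<partial>ms n)"
        by (rule SUP_upper) (use u in simp)
      also have "\<dots> < ennreal e"
        using A by (intro d(2)[rule_format]) (simp_all add: emeasure_eq_measure ennreal_less_iff)
      finally show "(\<integral>\<^sup>+t\<in>A. ennreal \<bar>support_fun ?u (\<Gamma>s n t)\<bar> \<partial>ms n) \<le> ennreal e" by simp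
    qed simp
    also have "\<dots> = ennreal (e * norm f)" using e by (simp add: mult.commute flip: ennreal_mult)
    finally show "(\<integral>\<^sup>+t\<in>A. ennreal \<bar>support_fun f (\<Gamma>s n t)\<bar> \<partial>ms n) \<le> ennreal (e * norm f)" .
  qed
qed

lemma unif_abs_cont_scalar_integrals_fixed_functional:
  fixes \<Gamma>s :: "nat \<Rightarrow> 'a::topological_space \<Rightarrow> 'b::real_normed_vector set"
  assumes j: "unif_abs_cont_scalar_integrals ms \<Gamma>s" and ms: "\<And>n. ms n \<in> finite_borel_measures"
    and \<Gamma>s: "\<And>n t. \<Gamma>s n t \<in> cwk" and meas: "\<And>n. scalarly_measurable (\<Gamma>s n)" and e: "e > 0"
  shows "\<exists>d>0. \<forall>n. \<forall>A\<in>sets borel. measure (ms n) A < d \<longrightarrow>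
    (\<integral>\<^sup>+t\<in>A. ennreal \<bar>support_fun f (\<Gamma>s n t)\<bar> \<partial>ms n) \<le> ennreal e"
proof -
  have pos: "norm f + 1 > 0" by (simp add: add_nonneg_pos)
  then have e': "e / (norm f + 1) > 0" using e by simp
  obtain d where d: "d > 0" "\<And>n A g. A \<in> sets borel \<Longrightarrow> measure (ms n) A < d \<Longrightarrow>
      (\<integral>\<^sup>+t\<in>A. ennreal \<bar>support_fun g (\<Gamma>s n t)\<bar> \<partial>ms n) \<le> ennreal (e / (norm f + 1) * norm g)"
    by (rule unif_abs_cont_scalar_integralsD[OF j ms \<Gamma>s meas e']) blast
  have "e / (norm f + 1) * norm f \<le> e" using e pos by (simp add: field_simps)
  then have "ennreal (e / (norm f + 1) * norm f) \<le> ennreal e" by (rule ennreal_leI)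
  then show ?thesis using d(1) d(2)[where g = f] by (intro exI[of _ d]) (auto intro: order_trans)
qed

text \<open>A linear functional below \<open>p f = (LINT t:A|m. support_fun f (\<Gamma> t))\<close> is nearly dominated by the weakly
  compact set \<open>\<Union>t\<in>K. \<Gamma> t\<close> for a compact \<open>K\<close> that carries most of \<open>m\<close>, so it is an evaluation.\<close>

theorem pettis_integral_exists:
  fixes \<Gamma> :: "'a::t2_space \<Rightarrow> 'b::banach set"
  assumes m: "m \<in> finite_borel_measures" "radon m"
    and \<Gamma>: "\<And>t. \<Gamma> t \<in> cwk" and cont: "scalarly_continuous \<Gamma>"
    and int: "scalarly_integrable m \<Gamma>"
    and tail: "\<And>e. e > 0 \<Longrightarrow> \<exists>d>0. \<forall>E\<in>sets borel. measure m E < d \<longrightarrow>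
      (\<forall>f. (\<integral>\<^sup>+t\<in>E. ennreal \<bar>support_fun f (\<Gamma> t)\<bar> \<partial>m) \<le> ennreal (e * norm f))"
    and A: "A \<in> sets borel"
  shows "\<exists>C. has_pettis_integral m \<Gamma> A C"
proof -
  interpret finite_measure m by (rule finite_borel_measuresD[OF m(1)])
  note sets_m = finite_borel_measuresD(2)[OF m(1)]
  define p where "p f = (LINT t:A|m. support_fun f (\<Gamma> t))" for f
  have int1: "integrable m (\<lambda>t. support_fun f (\<Gamma> t))" for f
    using int by (simp add: scalarly_integrable_def)
  have si: "set_integrable m B (\<lambda>t. support_fun f (\<Gamma> t))" if "B \<in> sets borel" for f B
    using integrable_mult_indicator[OF _ int1, of B f] that sets_m by (simp add: set_integrable_def)
  have meas: "(\<lambda>t. support_fun f (\<Gamma> t)) \<in> borel_measurable borel" for f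
    using cont by (auto simp: scalarly_continuous_def intro: borel_measurable_continuous_onI)
  have sub: "sublinear (\<lambda>f. support_fun f (\<Gamma> t))" for t
    by (rule sublinear_support_fun[OF cwkD(1,2)[OF \<Gamma>]])
  have "sublinear p"
  proof (rule sublinearI)
    fix f g
    have "p (f + g) \<le> (LINT t:A|m. support_fun f (\<Gamma> t) + support_fun g (\<Gamma> t))"
      unfolding p_def using si[OF A]
      by (intro set_integral_mono set_integral_add sublinear_add[OF sub])
    also have "\<dots> = p f + p g" unfolding p_def using si[OF A] by (intro set_integral_add)
    finally show "p (f + g) \<le> p f + p g" .
  next
    show "p 0 = 0" by (simp add: p_def set_lebesgue_integral_def sublinear_0[OF sub])
  next
    fix c :: real and f assume "c > 0"
    then show "p (c *\<^sub>R f) \<le> c * p f"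
      by (simp add: p_def sublinear_scale[OF sub] set_integral_mult_right)
  qed
  moreover have "\<exists>x. \<phi> = eval_at x" if \<phi>: "linear \<phi>" "\<And>f. \<phi> f \<le> p f" for \<phi>
  proof -
    have "\<exists>W c. compactin weak_topology W \<and> W \<noteq> {} \<and> c \<ge> 0 \<and>
        (\<forall>f. \<phi> f \<le> c * max 0 (support_fun f W) + e * norm f)" if e: "e > 0" for e
    proof -
      obtain d where d: "d > 0" "\<And>E f. E \<in> sets borel \<Longrightarrow> measure m E < d \<Longrightarrow>
          (\<integral>\<^sup>+t\<in>E. ennreal \<bar>support_fun f (\<Gamma> t)\<bar> \<partial>m) \<le> ennreal (e * norm f)"
        using tail[OF e] by blast
      obtain K0 where K0: "compact K0" "measure m (UNIV - K0) < d"
        using radon_inner_approx[OF m, of UNIV d] d(1) by auto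
      \<comment> \<open>adding an arbitrary point makes \<open>K\<close> nonempty\<close>
      define K where "K = insert undefined K0"
      have K: "compact K" "K \<noteq> {}" "K \<in> sets borel"
        using K0 by (auto simp: K_def compact_imp_closed)
      define W where "W = (\<Union>t\<in>K. \<Gamma> t)"
      have W: "compactin weak_topology W" "W \<noteq> {}"
        using weakly_compact_UN[OF \<Gamma> cont K(1)] K(2) cwkD(2)[OF \<Gamma>] by (auto simp: W_def)
      have "\<phi> f \<le> measure m UNIV * max 0 (support_fun f W) + e * norm f" for f
      proof -
        have "measure m (A - K) \<le> measure m (UNIV - K0)"
          using A K K0(1) sets_m by (intro finite_measure_mono) (auto simp: K_def compact_imp_closed)
        then have "\<bar>LINT t:A - K|m. support_fun f (\<Gamma> t)\<bar> \<le> e * norm f"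
          using A K K0 e by (intro abs_set_integral_le[OF m(1) meas _ subset_refl d(2)]) auto
        moreover have "(LINT t:A \<inter> K|m. support_fun f (\<Gamma> t)) \<le> measure m UNIV * max 0 (support_fun f W)"
        proof -
          have "(LINT t:A \<inter> K|m. support_fun f (\<Gamma> t)) \<le> (LINT t|m. max 0 (support_fun f W))"
            unfolding set_lebesgue_integral_def
          proof (rule integral_mono)
            show "integrable m (\<lambda>t. indicat_real (A \<inter> K) t *\<^sub>R support_fun f (\<Gamma> t))"
              using si[of "A \<inter> K" f] A K(3) by (simp add: set_integrable_def)
            fix t
            have "support_fun f (\<Gamma> t) \<le> support_fun f W" if "t \<in> K"
            proof -
              obtain x where "x \<in> \<Gamma> t" "blinfun_apply f x = support_fun f (\<Gamma> t)"
                by (rule support_fun_attained[OF cwkD(1,2)[OF \<Gamma>]])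
              moreover from this that have "x \<in> W" by (auto simp: W_def)
              ultimately show ?thesis using support_fun_upper[OF W(1), of x f] by simp
            qed
            then show "indicat_real (A \<inter> K) t *\<^sub>R support_fun f (\<Gamma> t) \<le> max 0 (support_fun f W)"
              by (auto simp: indicator_def)
          qed simp
          then show ?thesis by (simp add: finite_borel_measuresD(3)[OF m(1)])
        qed
        moreover have "p f = (LINT t:A - K|m. support_fun f (\<Gamma> t)) + (LINT t:A \<inter> K|m. support_fun f (\<Gamma> t))"
          unfolding p_def by (rule set_integral_split[OF m(1) int1 A K(3)])
        ultimately show ?thesis using \<phi>(2)[of f] by linarith
      qed
      then show ?thesis using W by (intro exI[of _ W] exI[of _ "measure m UNIV"]) auto
    qed
    then obtain x where "\<phi> = eval_at x" by (rule eval_if_nearly_dominated[OF \<phi>(1)])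
    then show ?thesis ..
  qed
  ultimately obtain C where "C \<in> cwk" "\<forall>f. support_fun f C = p f"
    using ex_cwk_support_fun[of p] by blast
  then show ?thesis by (auto simp: has_pettis_integral_def p_def)
qed

theorem theorem4p2:
  fixes \<Gamma> :: "'a::t2_space \<Rightarrow> 'b::banach set"
    and \<Gamma>s :: "nat \<Rightarrow> 'a \<Rightarrow> 'b set"
    and m :: "'a measure"
    and ms :: "nat \<Rightarrow> 'a measure"
  assumes "locally_compact_space (euclidean :: 'a topology)"
    and "\<And>t. \<Gamma> t \<in> cwk" and "\<And>n t. \<Gamma>s n t \<in> cwk"
    and "scalarly_measurable \<Gamma>" and "\<And>n. scalarly_measurable (\<Gamma>s n)"
    and "m \<in> finite_borel_measures" and "radon m"
    and "\<And>n. ms n \<in> finite_borel_measures"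
    and j: "unif_abs_cont_scalar_integrals ms \<Gamma>s"
      "unif_abs_cont_scalar_integrals ms (\<lambda>n. \<Gamma>)"
    and jj: "\<And>f. AE t in m. (\<lambda>n. support_fun f (\<Gamma>s n t)) \<longlonglongrightarrow> support_fun f (\<Gamma> t)"
    and jjj: "scalarly_continuous \<Gamma>"
    and jv: "vaguely_converges ms m" "unif_abs_continuous ms m"
    and v: "\<And>n. pettis_integrable (ms n) (\<Gamma>s n)"
  shows "pettis_integrable m \<Gamma> \<and>
    (\<forall>f. \<forall>A\<in>sets borel.
      (\<lambda>n. support_fun f (pettis_integral (ms n) (\<Gamma>s n) A))
        \<longlonglongrightarrow> support_fun f (pettis_integral m \<Gamma> A))"
proof -
  note \<Gamma> = assms(2) and \<Gamma>s = assms(3) and sm = assms(4) and sms = assms(5)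
    and m = assms(6) and ms = assms(8)
  have sw: "converges_setwise ms m"
    unfolding converges_setwise_def
    using vague_imp_setwise[OF assms(1) m assms(7) ms jv] by blast
  have meas: "(\<lambda>t. support_fun f (\<Gamma> t)) \<in> borel_measurable borel"
    "(\<lambda>t. support_fun f (\<Gamma>s n t)) \<in> borel_measurable borel" for f n
    using sm sms by (auto simp: scalarly_measurable_def)
  have int: "integrable (ms n) (\<lambda>t. support_fun f (\<Gamma> t))" "integrable (ms n) (\<lambda>t. support_fun f (\<Gamma>s n t))" for f n
    using j by (auto simp: unif_abs_cont_scalar_integrals_def scalarly_integrable_def)
  have tail: "\<exists>d>0. \<forall>E\<in>sets borel. measure m E < d \<longrightarrow>
      (\<forall>f. (\<integral>\<^sup>+t\<in>E. ennreal \<bar>support_fun f (\<Gamma> t)\<bar> \<partial>m) \<le> ennreal (e * norm f))" if e: "e > 0" for e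
  proof -
    obtain d where d: "d > 0" "\<And>n A f. A \<in> sets borel \<Longrightarrow> measure (ms n) A < d \<Longrightarrow>
        (\<integral>\<^sup>+t\<in>A. ennreal \<bar>support_fun f (\<Gamma> t)\<bar> \<partial>ms n) \<le> ennreal (e * norm f)"
      by (rule unif_abs_cont_scalar_integralsD[OF j(2) ms \<Gamma> sm e]) blast
    have "(\<integral>\<^sup>+t\<in>E. ennreal \<bar>support_fun f (\<Gamma> t)\<bar> \<partial>m) \<le> ennreal (e * norm f)"
      if "E \<in> sets borel" "measure m E < d" for E f
      by (rule setwise_limit_tail_bound[OF m ms sw meas(1) d(2) _ that]) (use e in auto)
    then show ?thesis using d(1) by blast
  qed
  have "integrable m (\<lambda>t. support_fun f (\<Gamma> t))" for f
  proof -
    obtain d where d: "d > 0" "\<And>E. E \<in> sets borel \<Longrightarrow> measure m E < d \<Longrightarrow>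
        (\<integral>\<^sup>+t\<in>E. ennreal \<bar>support_fun f (\<Gamma> t)\<bar> \<partial>m) \<le> ennreal (1 * norm f)"
      using tail[OF zero_less_one] by blast
    show ?thesis by (rule integrable_of_tail_bounds[OF m meas(1) d])
  qed
  then have si: "scalarly_integrable m \<Gamma>" by (simp add: scalarly_integrable_def)
  have pe: "\<exists>C. has_pettis_integral m \<Gamma> A C" if "A \<in> sets borel" for A
    by (rule pettis_integral_exists[OF m assms(7) \<Gamma> jjj si tail that])
  have "(\<lambda>n. support_fun f (pettis_integral (ms n) (\<Gamma>s n) A)) \<longlonglongrightarrow> support_fun f (pettis_integral m \<Gamma> A)"
    if A: "A \<in> sets borel" for f A
  proof -
    have "has_pettis_integral (ms n) (\<Gamma>s n) A (pettis_integral (ms n) (\<Gamma>s n) A)" for n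
      using v[of n] A unfolding pettis_integrable_def pettis_integral_def by (metis someI_ex)
    then have 1: "support_fun f (pettis_integral (ms n) (\<Gamma>s n) A) = (LINT t:A|ms n. support_fun f (\<Gamma>s n t))" for n
      by (simp add: has_pettis_integral_def)
    have "has_pettis_integral m \<Gamma> A (pettis_integral m \<Gamma> A)"
      unfolding pettis_integral_def using pe[OF A] by (rule someI_ex)
    then have 2: "support_fun f (pettis_integral m \<Gamma> A) = (LINT t:A|m. support_fun f (\<Gamma> t))"
      by (simp add: has_pettis_integral_def)
    show ?thesis
      unfolding 1 2
      by (rule vitali_varying_measures[OF m ms sw jv(2) meas(1) int(1) meas(2) int(2) _ _ jj A])
        (use unif_abs_cont_scalar_integrals_fixed_functional[OF j(2) ms \<Gamma> sm]
          unif_abs_cont_scalar_integrals_fixed_functional[OF j(1) ms \<Gamma>s sms] in blast)+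
  qed
  then show ?thesis using si pe by (auto simp: pettis_integrable_def)
qed

end
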